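(* Let $p$ be a prime, let $k,\ell$ be positive integers, and write $q:=p^k$ and $Q:=p^\ell$. Let $r$ be a positive integer such that $r\equiv Q+1\pmod{q+1}$. Let $a,b,c,d\in\mathbb{F}_{q^2}$ and write $A(X):=aX^{Q+1}+bX^Q+cX+d$. Then $X^rA(X^{q-1})$ permutes $\mathbb{F}_{q^2}$ if and only if $p=2$, $\gcd(r,q-1)=1$, and $A(X)=\delta A_0(\gamma X)$ for some $\gamma\in\mu_{q+1}$, some $\delta\in\mathbb{F}_{q^2}^*$, and some $A_0(X)\in\mathbb{F}_{q^2}[X]$ such that one of the following holds: (1) $\mathrm{ord}_2(k)\le\mathrm{ord}_2(\ell)$ and there exist $\alpha,\beta\in\mathbb{F}_{q^2}\setminus\mathbb{F}_q$ for which $$A_0(X)=(\alpha^{Q+1}+\beta)X^{Q+1}+(\alpha^{q+Q}+\beta)X^Q+(\alpha^{qQ+1}+\beta)X+(\alpha^{qQ+q}+\beta);$$ (2) $\mathrm{ord}_2(k)\ne\mathrm{ord}_2(\ell)$ and either $A_0(X)=X^{Q+1}$ or there exist $\alpha,\beta\in\mathbb{F}_{q^2}\setminus\mu_{q+1}$ for which $$A_0(X)=(\alpha^{qQ+q}+\beta)X^{Q+1}+(\alpha^{qQ}+\alpha\beta)X^Q+(\alpha^q+\alpha^Q\beta)X+(1+\alpha^{Q+1}\beta);$$ (3) $\mathrm{ord}_2(k)\ge\mathrm{ord}_2(\ell)$ and either $A_0(X)=X^Q$ or there exist $\alpha,\beta\in\mathbb{F}_{q^2}\setminus\mu_{q+1}$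 for which $$A_0(X)=(\alpha^{qQ}+\alpha^q\beta)X^{Q+1}+(\alpha^{qQ+1}+\beta)X^Q+(1+\alpha^{q+Q}\beta)X+(\alpha+\alpha^Q\beta).$$
   Context: A polynomial $f(X)\in\mathbb{F}_{q^2}[X]$ permutes $\mathbb{F}_{q^2}$ if $\alpha\mapsto f(\alpha)$ is a bijection of $\mathbb{F}_{q^2}$. $\mu_{q+1}$ denotes the set of $(q+1)$-th roots of unity in $\mathbb{F}_{q^2}^*$. For a positive integer $n$, $\mathrm{ord}_2(n)$ is the largest integer $i\ge 0$ such that $2^i\mid n$. *)

theory Defs
  imports
    "HOL-Algebra.Algebraic_Closure_Type"
    "HOL-Library.Cardinality"
    "HOL-Number_Theory.Residues"
    "HOL-Computational_Algebra.Computational_Algebra"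
begin

hide_const (open) up_ring.monom up_ring.coeff

definition subfield_of_order :: "nat \<Rightarrow> 'a::finite_field set" where
  "subfield_of_order n = (THE K. subfield K (ring_of_type_algebra :: 'a ring) \<and> card K = n)"

definition roots_of_unity :: "nat \<Rightarrow> 'a::field set" where
  "roots_of_unity n = {x. x ^ n = 1}"

definition permutation_poly :: "'a::finite_field poly \<Rightarrow> bool" where
  "permutation_poly f \<longleftrightarrow> bij (poly f)"

definition quadrinomial :: "nat \<Rightarrow> 'a::field \<Rightarrow> 'a \<Rightarrow> 'a \<Rightarrow> 'a \<Rightarrow> 'a poly" where
  "quadrinomial Q a b c d = monom a (Q + 1) + monom b Q + monom c 1 + monom d 0"

text \<open>
  The definite description in \<^const>\<open>subfield_of_order\<close> is justified when the field has
  \<open>q\<^sup>2\<close> elements, \<open>q\<close> a prime power: its unique subfield of order \<open>q\<close> is the set of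
  fixed points of \<open>x \<mapsto> x\<^sup>q\<close>.
\<close>

lemma pow_fixed_points_card:
  fixes q :: nat
  assumes q: "q > 1" and card: "CARD('a::finite_field) = q\<^sup>2"
    and add: "\<And>x y :: 'a. (x + y) ^ q = x ^ q + y ^ q"
    and neg: "\<And>x :: 'a. (- x) ^ q = - (x ^ q)"
  shows "card {x :: 'a. x ^ q = x} = q"
proof -
  have roots: "card {x :: 'a. poly (monom 1 q + [:u, v:]) x = 0} \<le> q"
    and lead: "monom 1 q + [:u, v:] \<noteq> (0 :: 'a poly)" for u v
  proof -
    have "coeff (monom 1 q + [:u, v:] :: 'a poly) q = 1"
      using q by (auto simp: coeff_pCons split: nat.splits)
    thus nz: "monom 1 q + [:u, v:] \<noteq> (0 :: 'a poly)" by (metis coeff_0 zero_neq_one)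
    have "degree (monom 1 q + [:u, v:] :: 'a poly) \<le> q"
      using q by (intro degree_add_le degree_monom_le) (auto simp: degree_pCons_eq_if)
    with card_poly_roots_bound[OF nz]
    show "card {x :: 'a. poly (monom 1 q + [:u, v:]) x = 0} \<le> q" by linarith
  qed
  define f where "f = (\<lambda>x :: 'a. x ^ q - x)"
  define I where "I = range f"
  have pw: "(x ^ q) ^ q = x" for x :: 'a
    using finite_field_power_card_eq_same[of x] card by (simp add: power_mult power2_eq_square)
  have "I \<subseteq> {y. poly (monom 1 q + [:0, 1:]) y = 0}"
  proof
    fix y assume "y \<in> I"
    then obtain x where y: "y = x ^ q + - x" by (auto simp: I_def f_def)
    have "y ^ q = x - x ^ q" unfolding y by (simp only: add neg pw) simp
    thus "y \<in> {y. poly (monom 1 q + [:0, 1:]) y = 0}"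
      by (simp add: poly_monom y)
  qed
  hence I: "card I \<le> q" using roots[of 0 1] card_mono[OF finite] order.trans by blast
  have le: "card {x. f x = y} \<le> q" for y
    using roots[of "- y" "- 1"] by (simp add: poly_monom f_def algebra_simps)
  have "q * q = card (UNIV :: 'a set)" using card by (simp add: power2_eq_square)
  also have "(UNIV :: 'a set) = (\<Union>y\<in>I. {x. f x = y})" by (auto simp: I_def)
  also have "card \<dots> = (\<Sum>y\<in>I. card {x. f x = y})"
    by (rule card_UN_disjoint) auto
  finally have tot: "q * q = (\<Sum>y\<in>I. card {x. f x = y})" .
  have 0: "0 \<in> I" unfolding I_def f_def using q by (auto intro!: image_eqI[of _ _ 0])
  have "card {x. f x = 0} = q"
  proof (rule ccontr)
    assume "card {x. f x = 0} \<noteq> q"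
    with le[of 0] have "card {x. f x = 0} < q" by linarith
    hence "(\<Sum>y\<in>I. card {x. f x = y}) < (\<Sum>y\<in>I. q)"
      using 0 le by (intro sum_strict_mono_ex1) auto
    also have "\<dots> \<le> q * q" using I by simp
    finally show False using tot by simp
  qed
  thus ?thesis by (simp add: f_def)
qed

lemma subfield_of_order_unique:
  fixes K :: "'a::finite_field set"
  assumes p: "prime p" and k: "k > 0" and card: "CARD('a) = (p ^ k)\<^sup>2"
  shows "subfield K (ring_of_type_algebra :: 'a ring) \<and> card K = p ^ k \<longleftrightarrow>
         K = {x. x ^ (p ^ k) = x}"
proof -
  let ?R = "ring_of_type_algebra :: 'a ring"
  define q where "q = p ^ k"
  define F where "F = {x :: 'a. x ^ q = x}"
  interpret R: field ?R by (rule field_from_type_algebra)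
  have ops [simp]: "carrier ?R = UNIV" "\<one>\<^bsub>?R\<^esub> = 1" "\<zero>\<^bsub>?R\<^esub> = 0"
    "x \<otimes>\<^bsub>?R\<^esub> y = x * y" "x \<oplus>\<^bsub>?R\<^esub> y = x + y" for x y
    by (simp_all add: ring_of_type_algebra_def)
  have minus: "\<ominus>\<^bsub>?R\<^esub> x = - x" for x
    using R.minus_equality[of "- x" x] by simp
  have inv: "inv\<^bsub>?R\<^esub> x = inverse x" if "x \<noteq> 0" for x
    using R.inv_char[of x "inverse x"] that by simp
  have q1: "q > 1" unfolding q_def using p k by (intro one_less_power prime_gt_1_nat)
  have "CHAR('a) dvd CARD('a)" by (rule CHAR_dvd_CARD)
  hence "CHAR('a) dvd p" using card p CHAR_prime prime_dvd_power by (metis power_mult)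
  hence char: "p = CHAR('a)" using p CHAR_prime[where 'a = 'a] primes_dvd_imp_eq by blast
  have add: "(x + y) ^ q = x ^ q + y ^ q" for x y :: 'a
    using freshmans_dream'[of q k x y] char by (simp add: q_def)
  have neg: "(- x) ^ q = - (x ^ q)" for x :: 'a
  proof -
    have "(- x) ^ q + x ^ q = 0" using add[of "- x" x] q1 by (simp add: power_0_left)
    thus ?thesis by (simp only: eq_neg_iff_add_eq_0)
  qed
  have cF: "card F = q"
    unfolding F_def by (rule pow_fixed_points_card) (use q1 card add neg in \<open>auto simp: q_def\<close>)
  have sub: "subfield F ?R"
    by (rule R.subfieldI', rule R.subringI)
       (auto simp: F_def minus inv add neg power_mult_distrib power_inverse)
  have unique: "K = F" if K: "subfield K ?R" and cK: "card K = q" for K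
  proof -
    have "x ^ q = x" if x: "x \<in> K" "x \<noteq> 0" for x
    proof -
      have fin: "finite K" by simp
      have mult: "u * v \<in> K" if "u \<in> K" "v \<in> K" for u v
        using subringE(6)[OF subfieldE(1)[OF K]] that by simp
      have 0: "0 \<in> K" using subringE(2)[OF subfieldE(1)[OF K]] by simp
      have inj: "inj_on ((*) x) (K - {0})" using x by (auto simp: inj_on_def)
      have "(*) x ` (K - {0}) = K - {0}"
        by (rule card_subset_eq) (use x mult inj in \<open>auto simp: card_image\<close>)
      hence "(\<Prod>y\<in>K - {0}. y) = (\<Prod>y\<in>K - {0}. x * y)"
        using prod.reindex[OF inj, of "\<lambda>y. y"] by simp
      also have "\<dots> = x ^ (q - 1) * (\<Prod>y\<in>K - {0}. y)"
        using 0 cK by (simp add: prod.distrib card_Diff_singleton)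
      finally have "x ^ (q - 1) = 1" by simp
      thus ?thesis using q1 power_minus_mult[of q x] by simp
    qed
    note nonzero = this
    have zero: "(0::'a) ^ q = 0" using q1 by simp
    have "K \<subseteq> F"
    proof
      fix x assume "x \<in> K"
      thus "x \<in> F" using nonzero[of x] zero by (cases "x = 0") (auto simp only: F_def mem_Collect_eq)
    qed
    thus ?thesis using card_subset_eq[of F K] cK cF by simp
  qed
  have "subfield K ?R \<and> card K = q \<longleftrightarrow> K = F"
    using sub unique cF by metis
  thus ?thesis by (simp only: F_def q_def)
qed

lemma subfield_of_order_eq:
  assumes "prime p" "k > 0" "CARD('a::finite_field) = (p ^ k)\<^sup>2"
  shows "(subfield_of_order (p ^ k) :: 'a set) = {x. x ^ (p ^ k) = x}"
  unfolding subfield_of_order_def by (simp only: subfield_of_order_unique[OF assms] the_eq_trivial)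

end

(*
  On mu, the (q+1)-st roots of unity, let A~(x) = x^(Q+1) A(x)^q. The polynomial permutes the
  field iff gcd(r, q-1) = 1, A has no zero on mu and A~/A is injective on mu. The fibre of A~/A
  over y is the zero set on mu of A~ - yA, which is a bilinear form in (x, x^Q) with coefficients
  affine in y; its determinant h(y) is quadratic and h is proportional to its own conjugate
  reciprocal.

  If h has a root y in mu, then A~ - yA is a product (x - x1)(x - x2)^Q with x1, x2 in mu, so
  injectivity forces x1 = x2; a double root of h would make A vanish at x1, so there are two such
  roots, A = e1 (x - x1)^(Q+1) + e2 (x - x2)^(Q+1), and A~/A becomes t -> t^(Q+1) on the
  projective line over F_q. Otherwise a root of h in F_(q^2) gives A = e B + f B~ with
  B = u(x) v(x)^Q and u, v linear without zeros on mu. In the coordinate z = v~/v of mu, the map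
  B~/B is z^Q times the Moebius map u~/u of z. Summing its values over mu shows that it is not
  injective unless u is proportional to v or v~, i.e. unless it is a multiple of z^(Q+1) or
  z^(Q-1).
*)

theory Submission
  imports Defs
begin

text \<open>The condition \<open>p = 2\<close> comes from exponents alone. The maps that survive are
  t^(Q+1) on F_q and z^(Q+1), z^(Q-1) on \<open>mu\<close>, so injectivity says that gcd(Q+1, q-1),
  gcd(Q+1, q+1) or gcd(Q-1, q+1) is 1. For odd \<open>p\<close> all three are even; for
  \<open>p = 2\<close> each is decided by comparing the powers of 2 in \<open>k\<close> and
  \<open>l\<close>. The quadratic h has coefficients in F_(q^2), so a root there is not automatic.
  After its variable is scaled by the leading coefficient, h becomes a quadratic over F_q, and these
  always split in F_(q^2). The factorization u(x) v(x)^Q of a degenerate form then relies on every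
  element having a Q-th root. In the normal forms \<alpha> records the linear factors after
  rescaling, and \<beta> the ratio of the two summands.\<close>

section \<open>Roots of unity in a finite field\<close>

lemma card_power_eq_1_le:
  assumes "n > 0"
  shows "card {x::'a::finite_field. x ^ n = 1} \<le> n"
proof -
  let ?P = "monom 1 n - 1 :: 'a poly"
  have "coeff ?P n = 1" using assms by (simp add: coeff_1)
  hence nz: "?P \<noteq> 0" by (metis coeff_0 zero_neq_one)
  have "degree ?P \<le> n" by (intro degree_diff_le degree_monom_le) auto
  moreover have "{x. poly ?P x = 0} = {x. x ^ n = 1}" by (simp add: poly_monom)
  ultimately show ?thesis using card_poly_roots_bound[OF nz] by simp
qed

lemma ex_power_neq_1:
  assumes "0 < n" "n < card (S :: 'a::finite_field set)"
  shows "\<exists>x\<in>S. x ^ n \<noteq> 1"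
proof (rule ccontr)
  assume "\<not> ?thesis"
  hence "card S \<le> card {x::'a. x ^ n = 1}" by (intro card_mono) auto
  with card_power_eq_1_le[OF assms(1), where 'a = 'a] assms(2) show False by simp
qed

lemma power_cancel_coprime:
  fixes x :: "'a::field"
  assumes "coprime m n" "x ^ m = y ^ m" "x ^ n = y ^ n" "y \<noteq> 0"
  shows "x = y"
proof -
  define z where "z = x / y"
  \<comment> \<open>\<open>x = 0\<close> would force \<open>m = n = 0\<close> because
    \<open>y\<close> is nonzero, and 0 is not coprime to itself; hence \<open>z\<close> is nonzero
    and negative Bezout exponents make sense.\<close>
  have z: "z ^ m = 1" "z ^ n = 1" "z \<noteq> 0"
    using assms by (auto simp: z_def power_divide) (metis power_0_left power_eq_0_iff coprime_0_left_iff is_unit_gcd coprime_commute coprime_0_right_iff zero_neq_one power_one_right nat_dvd_1_iff_1)+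
  obtain u v where "int m * u + int n * v = 1"
    using bezout_int[of "int m" "int n"] assms(1) by (auto simp: mult.commute coprime_iff_gcd_eq_1)
  hence "z = z powi (int m * u + int n * v)" by simp
  also have "\<dots> = (z ^ m) powi u * (z ^ n) powi v"
    using z(3) by (simp add: power_int_add power_int_mult)
  also have "\<dots> = 1" using z by simp
  finally show ?thesis using assms(4) by (simp add: z_def)
qed

lemma alg_closed_quadratic_root:
  "\<exists>x::'a::alg_closed_field. x ^ 2 - t * x + n = 0"
proof -
  have "\<exists>x. poly [:n, - t, 1:] x = 0"
    by (rule alg_closed_imp_poly_has_root) (simp)
  thus ?thesis by (auto simp: power2_eq_square algebra_simps)
qed

section \<open>Common divisors of 2^l + 1 and 2^k - 1 or 2^k + 1\<close>

text \<open>Here \<open>g\<close> is the full power of 2 in \<open>k\<close>, not gcd(k, l): only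
  the parities of the cofactors matter later.\<close>

lemma multiplicity_2_le_decompose:
  fixes k l :: nat
  assumes "k > 0" "l > 0" "multiplicity 2 k \<le> multiplicity 2 l"
  obtains g k' l' where "k = g * k'" "l = g * l'" "g > 0" "odd k'"
    "even l' \<longleftrightarrow> multiplicity 2 k < multiplicity 2 l"
proof -
  obtain k' where k': "k = 2 ^ multiplicity 2 k * k'" "odd k'"
    using multiplicity_decompose'[of k 2] assms(1) by auto
  obtain l' where l': "l = 2 ^ multiplicity 2 l * l'" "odd l'"
    using multiplicity_decompose'[of l 2] assms(2) by auto
  let ?m = "multiplicity 2 l - multiplicity 2 k"
  have "(2::nat) ^ multiplicity 2 l = 2 ^ multiplicity 2 k * 2 ^ ?m"
    using assms(3) by (simp flip: power_add)
  hence "l = 2 ^ multiplicity 2 k * (2 ^ ?m * l')"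
    using l'(1) by (metis mult.assoc)
  moreover have "even (2 ^ ?m * l') \<longleftrightarrow> multiplicity 2 k < multiplicity 2 l"
    using l'(2) by auto
  ultimately show thesis using k' that by (metis pos2 zero_less_power)
qed

text \<open>Evaluate x^(g k' l') in two ways: as (x^l)^k' it is -1, as (x^k)^l' it is 1, so
  \<open>d\<close> divides 2. Taking \<open>s\<close> to be 1 or -1 serves both gcds.\<close>

lemma odd_dvd_cong_minus_1:
  fixes d x :: int
  assumes "odd d" "[x ^ l = - 1] (mod d)" "[x ^ k = s] (mod d)"
    and "k = g * k'" "l = g * l'" "odd k'" "s ^ l' = 1"
  shows "is_unit d"
proof -
  have "[- 1 = (x ^ l) ^ k'] (mod d)"
    using cong_pow[OF assms(2), of k'] assms(6) by (simp add: cong_sym)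
  also have "(x ^ l) ^ k' = (x ^ k) ^ l'"
    using assms(4,5) by (simp add: mult_ac flip: power_mult)
  also have "[(x ^ k) ^ l' = 1] (mod d)"
    using cong_pow[OF assms(3), of l'] assms(7) by simp
  finally have "d dvd 2" by (simp add: cong_iff_dvd_diff)
  with assms(1) show ?thesis
    using coprime_common_divisor[of d 2 d] by auto
qed

lemma cong_power_odd: "odd n \<Longrightarrow> [(x ^ g) ^ n = - 1] (mod (x ^ g + 1))"
  and cong_power_even: "even n \<Longrightarrow> [(x ^ g) ^ n = 1] (mod (x ^ g + 1))"
  for x :: int
  using cong_pow[of "x ^ g" "-1" "x ^ g + 1" n] by (auto simp: cong_iff_dvd_diff)

text \<open>A divisor of an odd number is odd, so only odd \<open>d\<close> need testing. Integers
  replace naturals to allow congruences to -1.\<close>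

lemma coprime_iff_of_int:
  fixes m n :: nat
  assumes "odd m \<or> odd n"
  shows "coprime m n \<longleftrightarrow> (\<forall>d::int. odd d \<and> d dvd int m \<and> d dvd int n \<longrightarrow> is_unit d)"
proof -
  have "coprime m n \<longleftrightarrow> coprime (int m) (int n)" by simp
  also have "\<dots> \<longleftrightarrow> (\<forall>d. odd d \<and> d dvd int m \<and> d dvd int n \<longrightarrow> is_unit d)"
    using assms unfolding coprime_def by (metis dvd_trans even_of_nat)
  finally show ?thesis .
qed

lemma coprime_2_power_plus_minus:
  fixes k l :: nat
  assumes "k > 0" "l > 0"
  shows "coprime (2 ^ l + 1) (2 ^ k - 1 :: nat) \<longleftrightarrow> multiplicity 2 k \<le> multiplicity 2 l"
proof -
  have iff: "coprime (2 ^ l + 1) (2 ^ k - 1 :: nat) \<longleftrightarrow>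
      (\<forall>d::int. odd d \<and> [2 ^ l = - 1] (mod d) \<and> [2 ^ k = 1] (mod d) \<longrightarrow> is_unit d)"
    using assms by (subst coprime_iff_of_int) (simp_all add: cong_iff_dvd_diff of_nat_diff add.commute)
  show ?thesis
  proof (cases "multiplicity 2 k \<le> multiplicity 2 l")
    case True
    obtain g k' l' where *: "k = g * k'" "l = g * l'" "odd k'"
      using multiplicity_2_le_decompose[OF assms True] by metis
    have "is_unit d" if "odd d" "[2 ^ l = - 1] (mod d)" "[2 ^ k = 1] (mod d)" for d :: int
      by (rule odd_dvd_cong_minus_1[OF that *]) simp
    thus ?thesis using True iff by blast
  next
    case False
    obtain g k' l' where *: "k = g * k'" "l = g * l'" "odd l'" "even k'" "g > 0"
      using multiplicity_2_le_decompose[OF assms(2,1)] False by (metis not_le less_imp_le)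
    \<comment> \<open>Modulo this number 2^g is -1; \<open>l'\<close> is odd and \<open>k'\<close>
      is even, which makes it a common divisor greater than 1.\<close>
    let ?d = "2 ^ g + 1 :: int"
    have "odd ?d" "\<not> is_unit ?d" "[2 ^ l = - 1] (mod ?d)" "[2 ^ k = 1] (mod ?d)"
      using * cong_power_odd[of l' 2 g] cong_power_even[of k' 2 g]
      by (auto simp: power_mult zdvd1_eq)
    thus ?thesis using False iff by blast
  qed
qed

lemma coprime_2_power_plus_plus:
  fixes k l :: nat
  assumes "k > 0" "l > 0"
  shows "coprime (2 ^ l + 1) (2 ^ k + 1 :: nat) \<longleftrightarrow> multiplicity 2 k \<noteq> multiplicity 2 l"
proof -
  have iff: "coprime (2 ^ l + 1) (2 ^ k + 1 :: nat) \<longleftrightarrow>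
      (\<forall>d::int. odd d \<and> [2 ^ l = - 1] (mod d) \<and> [2 ^ k = - 1] (mod d) \<longrightarrow> is_unit d)"
    using assms by (subst coprime_iff_of_int) (simp_all add: cong_iff_dvd_diff add.commute)
  show ?thesis
  proof (cases "multiplicity 2 k = multiplicity 2 l")
    case True
    obtain g k' l' where *: "k = g * k'" "l = g * l'" "odd k'" "odd l'" "g > 0"
      using multiplicity_2_le_decompose[OF assms] True by (metis less_irrefl order_refl)
    \<comment> \<open>Both cofactors are odd, so both powers of 2 are -1 modulo this number.\<close>
    let ?d = "2 ^ g + 1 :: int"
    have "odd ?d" "\<not> is_unit ?d" "[2 ^ l = - 1] (mod ?d)" "[2 ^ k = - 1] (mod ?d)"
      using * cong_power_odd[of l' 2 g] cong_power_odd[of k' 2 g]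
      by (auto simp: power_mult zdvd1_eq)
    thus ?thesis using True iff by blast
  next
    case False
    then consider "multiplicity 2 k < multiplicity 2 l" | "multiplicity 2 l < multiplicity 2 k"
      by linarith
    hence "is_unit d" if d: "odd d" "[2 ^ l = - 1] (mod d)" "[2 ^ k = - 1] (mod d)" for d :: int
    proof cases
      case 1
      then obtain g k' l' where *: "k = g * k'" "l = g * l'" "odd k'" and "even l'"
        using multiplicity_2_le_decompose[OF assms] by (metis less_imp_le)
      \<comment> \<open>Here \<open>s\<close> is -1, and the even cofactor turns it into 1; the
        other case exchanges the roles of \<open>k\<close> and \<open>l\<close>.\<close>
      thus ?thesis by (intro odd_dvd_cong_minus_1[OF d *]) simp
    next
      case 2
      then obtain g k' l' where *: "l = g * l'" "k = g * k'" "odd l'" and "even k'"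
        using multiplicity_2_le_decompose[OF assms(2,1)] by (metis less_imp_le)
      thus ?thesis by (intro odd_dvd_cong_minus_1[OF d(1,3,2) *]) simp
    qed
    thus ?thesis using False iff by blast
  qed
qed

text \<open>For odd \<open>p\<close> both numbers are even. This and the companion below are where
  \<open>p = 2\<close> enters the theorem.\<close>

lemma coprime_prime_power_plus_minus:
  fixes p :: nat
  assumes "prime p" "k > 0" "l > 0"
  shows "coprime (p ^ l + 1) (p ^ k - 1) \<longleftrightarrow> p = 2 \<and> multiplicity 2 k \<le> multiplicity 2 l"
proof (cases "p = 2")
  case False
  with assms have "even (p ^ l + 1)" "even (p ^ k - 1)"
    using prime_odd_nat[of p] prime_ge_2_nat[of p] by auto
  thus ?thesis using False coprime_common_divisor_nat[of "p ^ l + 1" "p ^ k - 1" 2] by auto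
qed (use coprime_2_power_plus_minus[OF assms(2,3)] in simp)

lemma coprime_prime_power_plus_plus:
  fixes p :: nat
  assumes "prime p" "k > 0" "l > 0"
  shows "coprime (p ^ l + 1) (p ^ k + 1) \<longleftrightarrow> p = 2 \<and> multiplicity 2 k \<noteq> multiplicity 2 l"
proof (cases "p = 2")
  case False
  with assms have "even (p ^ l + 1)" "even (p ^ k + 1)"
    using prime_odd_nat[of p] prime_ge_2_nat[of p] by auto
  thus ?thesis using False coprime_common_divisor_nat[of "p ^ l + 1" "p ^ k + 1" 2] by auto
qed (use coprime_2_power_plus_plus[OF assms(2,3)] in simp)

text \<open>The count \<open>card S = N\<close> replaces cyclicity: if d = gcd(n, N) exceeds 1, then
  X^(N/d) - 1 has too few roots to vanish on \<open>S\<close>, so some x^(N/d) is a nontrivial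
  element whose n-th power is 1. The converse is cancellation by Bezout.\<close>

lemma inj_on_power_iff:
  fixes S :: "'a::finite_field set"
  assumes S: "S = {x. x ^ N = 1}" "card S = N" "N > 0"
  shows "inj_on (\<lambda>x. x ^ n) S \<longleftrightarrow> coprime n N"
proof
  assume inj: "inj_on (\<lambda>x. x ^ n) S"
  show "coprime n N"
  proof (rule ccontr)
    assume "\<not> coprime n N"
    define d where "d = gcd n N"
    have "d \<noteq> 1" "d > 0" using \<open>\<not> coprime n N\<close> S(3) by (auto simp: d_def coprime_iff_gcd_eq_1)
    hence d: "d > 1" by simp
    have dvd: "d dvd n" "d dvd N" by (auto simp: d_def)
    have "0 < N div d" "N div d < card S"
      using d dvd S by (auto simp: div_greater_zero_iff dvd_imp_le)
    then obtain x where x: "x \<in> S" "x ^ (N div d) \<noteq> 1"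
      using ex_power_neq_1 by blast
    define y where "y = x ^ (N div d)"
    have "y ^ d = x ^ N" using dvd by (simp add: y_def flip: power_mult)
    hence "y ^ d = 1" using x S by simp
    hence "y ^ n = 1" "y ^ N = 1"
      using dvd by (auto elim!: dvdE simp: power_mult)
    hence "y \<in> S" "1 \<in> S" "y ^ n = 1 ^ n" using S by auto
    hence "y = 1" using inj unfolding inj_on_def by blast
    with x show False by (simp add: y_def)
  qed
next
  assume c: "coprime n N"
  show "inj_on (\<lambda>x. x ^ n) S"
  proof (rule inj_onI)
    fix x y assume xy: "x \<in> S" "y \<in> S" "x ^ n = y ^ n"
    hence "y \<noteq> 0" "x ^ N = y ^ N" using S by (auto simp: power_0_left)
    thus "x = y" using power_cancel_coprime[OF c xy(3)] by simp
  qed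
qed

section \<open>Conjugation over F_q and the norm-one group \<open>mu\<close>\<close>

locale quadratic_finite_field =
  fixes K :: "'a::finite_field itself" and p k q :: nat
  assumes prime_p: "prime p" and k_pos: "k > 0" and q_def: "q = p ^ k"
    and card_K: "CARD('a) = q\<^sup>2"
begin

definition cj :: "'a \<Rightarrow> 'a" where "cj x = x ^ q"

text \<open>The norm-one description makes conjugation on \<open>mu\<close> the same as inversion,
  which is how it enters nearly every computation.\<close>

definition mu :: "'a set" where "mu = {x. x * cj x = 1}"

lemma q_gt_1: "q > 1"
  unfolding q_def using prime_p k_pos by (intro one_less_power prime_gt_1_nat)

lemma CHAR_eq: "CHAR('a) = p"
proof -
  have "CHAR('a) dvd CARD('a)" by (rule CHAR_dvd_CARD)
  hence "CHAR('a) dvd p"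
    using card_K q_def CHAR_prime[where 'a = 'a] prime_dvd_power by (metis power_mult)
  thus ?thesis using prime_p CHAR_prime[where 'a = 'a] primes_dvd_imp_eq by blast
qed

lemma frob_add: "(x + y :: 'a) ^ p ^ n = x ^ p ^ n + y ^ p ^ n"
  using freshmans_dream'[of "p ^ n" n x y] CHAR_eq prime_p by simp

lemma frob_diff: "(x - y :: 'a) ^ p ^ n = x ^ p ^ n - y ^ p ^ n"
  using frob_add[of "x - y" y n] by (simp add: algebra_simps)

lemma frob_minus: "(- x :: 'a) ^ p ^ n = - (x ^ p ^ n)"
  using frob_diff[of 0 x n] prime_gt_0_nat[OF prime_p] by (simp add: power_0_left)

lemma frob_eq_iff: "(x :: 'a) ^ p ^ n = y ^ p ^ n \<longleftrightarrow> x = y"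
  using frob_diff[of x y n] by (metis eq_iff_diff_eq_0 power_eq_0_iff)

lemma frob_root: "\<exists>y::'a. y ^ p ^ n = x"
proof -
  have "inj (\<lambda>y::'a. y ^ p ^ n)" by (auto simp: inj_on_def frob_eq_iff)
  hence "surj (\<lambda>y::'a. y ^ p ^ n)" by (simp add: finite_UNIV_inj_surj)
  thus ?thesis by (metis surjD)
qed

lemma cj_add [simp]: "cj (x + y) = cj x + cj y"
  and cj_diff [simp]: "cj (x - y) = cj x - cj y"
  and cj_minus [simp]: "cj (- x) = - cj x"
  unfolding cj_def by (simp_all only: q_def frob_add frob_diff frob_minus)

lemma cj_mult [simp]: "cj (x * y) = cj x * cj y"
  and cj_divide [simp]: "cj (x / y) = cj x / cj y"
  and cj_inverse [simp]: "cj (inverse x) = inverse (cj x)"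
  and cj_1 [simp]: "cj 1 = 1"
  by (simp_all add: cj_def power_mult_distrib power_divide power_inverse)

lemma cj_power [simp]: "cj (x ^ n) = cj x ^ n"
  by (simp add: cj_def flip: power_mult) (simp add: mult.commute)

lemma cj_eq_0_iff [simp]: "cj x = 0 \<longleftrightarrow> x = 0"
  using q_gt_1 by (simp add: cj_def)

lemma cj_0 [simp]: "cj 0 = 0" by simp

lemma cj_cj [simp]: "cj (cj x) = x"
  using finite_field_power_card_eq_same[of x] card_K
  by (simp add: cj_def power2_eq_square flip: power_mult)

lemma cj_eq_iff [simp]: "cj x = cj y \<longleftrightarrow> x = y"
  by (metis cj_cj)

lemma mu_iff: "x \<in> mu \<longleftrightarrow> x \<noteq> 0 \<and> cj x = 1 / x"
  by (auto simp: mu_def eq_divide_eq mult.commute)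

lemma mu_iff_power: "x \<in> mu \<longleftrightarrow> x ^ (q + 1) = 1"
  by (simp add: mu_def cj_def)

lemma one_in_mu [simp]: "1 \<in> mu" by (simp add: mu_def)

lemma mu_mult: "x \<in> mu \<Longrightarrow> y \<in> mu \<Longrightarrow> x * y \<in> mu"
  and mu_divide: "x \<in> mu \<Longrightarrow> y \<in> mu \<Longrightarrow> x / y \<in> mu"
  and mu_power: "x \<in> mu \<Longrightarrow> x ^ n \<in> mu"
  by (auto simp: mu_iff power_one_over)

lemma card_fixed: "card {x. cj x = x} = q"
  unfolding cj_def
  by (rule pow_fixed_points_card) (use q_gt_1 card_K cj_add cj_minus in \<open>auto simp: cj_def\<close>)

text \<open>A squeeze: the (q+1)(q-1) nonzero elements map to \<open>mu\<close> with fibres of size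
  at most q-1, so the image has at least q+1 elements, while \<open>mu\<close>, as a set of roots,
  has at most q+1.\<close>

lemma image_power_mu: "(\<lambda>x. x ^ (q - 1)) ` (- {0}) = mu"
  and card_mu: "card mu = q + 1"
proof -
  let ?f = "\<lambda>x::'a. x ^ (q - 1)"
  have f: "?f x = cj x / x" if "x \<noteq> 0" for x
    using that q_gt_1 power_minus_mult[of q x] by (simp add: cj_def eq_divide_eq)
  have "?f x \<in> mu" if "x \<noteq> 0" for x
    unfolding f[OF that] mu_iff using that by simp
  hence sub: "?f ` (- {0}) \<subseteq> mu" by blast
  have le: "card mu \<le> q + 1"
    using card_power_eq_1_le[of "q + 1", where 'a = 'a] by (simp add: mu_def cj_def)
  have fib: "card {x \<in> -{0}. ?f x = y} \<le> q - 1" if "y \<in> ?f ` (- {0})" for y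
  proof -
    from that obtain z where z: "z \<noteq> 0" "y = ?f z" by auto
    have "card {x \<in> -{0}. ?f x = y} \<le> card {x::'a. x ^ (q - 1) = 1}"
      by (rule card_inj_on_le[where f = "\<lambda>x. x / z"])
         (use z in \<open>auto simp: inj_on_def power_divide\<close>)
    also have "\<dots> \<le> q - 1" using q_gt_1 by (intro card_power_eq_1_le) auto
    finally show ?thesis .
  qed
  have "(q + 1) * (q - 1) = card (- {0::'a})"
    using card_K by (simp add: card_Diff_singleton Compl_eq_Diff_UNIV power2_eq_square algebra_simps)
  also have "\<dots> = (\<Sum>y\<in>?f ` (- {0}). card {x \<in> -{0}. ?f x = y})"
    using sum.image_gen[of "- {0}" "\<lambda>_. 1::nat" ?f] by simp
  also have "\<dots> \<le> card (?f ` (- {0})) * (q - 1)"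
    using sum_bounded_above[OF fib] by simp
  finally have "q + 1 \<le> card (?f ` (- {0}))"
    using q_gt_1 by (subst (asm) mult_le_cancel2) simp
  with le card_mono[OF _ sub] show "card mu = q + 1" by simp
  with \<open>q + 1 \<le> card (?f ` (- {0}))\<close> show "?f ` (- {0}) = mu"
    using card_subset_eq[OF _ sub] card_mono[OF _ sub] by simp
qed

text \<open>x^(q-1) equals cj x / x for nonzero x, so this is surjectivity of that power map onto
  \<open>mu\<close>. It later supplies the parameter \<alpha> of the first normal form.\<close>

lemma hilbert90: "x \<in> mu \<Longrightarrow> \<exists>a. a \<noteq> 0 \<and> cj a = x * a"
proof -
  assume "x \<in> mu"
  then obtain a where "a \<noteq> 0" "x = a ^ (q - 1)" using image_power_mu by auto
  thus ?thesis using q_gt_1 power_minus_mult[of q a] by (auto simp: cj_def)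
qed

lemma ex_mu_neq_1: "\<exists>x\<in>mu. x \<noteq> 1"
  using ex_power_neq_1[of 1 mu] card_mu q_gt_1 by simp

lemma norm_eq_mu: "x * cj x = y * cj y \<Longrightarrow> y \<noteq> 0 \<Longrightarrow> x / y \<in> mu"
  by (simp add: mu_def)

lemma cj_div_self_mu: "x \<noteq> 0 \<Longrightarrow> cj x / x \<in> mu"
  by (simp add: mu_def)

lemma mu_frob_iff: "x ^ p ^ n \<in> mu \<longleftrightarrow> x \<in> mu"
  using frob_eq_iff[of "x * cj x" n 1] by (simp add: mu_def power_mult_distrib)


text \<open>Take a root \<open>w\<close> in the algebraic closure. The coefficients lie in F_q, so
  w^q is again a root, hence is \<open>w\<close> or the other root t - w; either way the q-power map
  applied twice fixes \<open>w\<close>, which puts \<open>w\<close> in F_(q^2).\<close>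

lemma quadratic_splits:
  assumes t: "cj t = t" and n: "cj n = n"
  shows "\<exists>x. x ^ 2 - t * x + n = 0"
proof -
  obtain w :: "'a alg_closure" where w: "w ^ 2 - to_ac t * w + to_ac n = 0"
    using alg_closed_quadratic_root by blast
  have char: "CHAR('a alg_closure) = p" by (simp add: CHAR_eq)
  have add: "(x + y) ^ q = x ^ q + y ^ q" for x y :: "'a alg_closure"
    using freshmans_dream'[of q k x y] char prime_p q_def by simp
  have diff: "(x - y) ^ q = x ^ q - y ^ q" for x y :: "'a alg_closure"
    using add[of "x - y" y] by (simp add: algebra_simps)
  have tn: "to_ac t ^ q = to_ac t" "to_ac n ^ q = to_ac n"
    using t n by (simp_all add: cj_def flip: to_ac_power)
  have "0 = (w ^ 2 - to_ac t * w + to_ac n) ^ q"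
    using w q_gt_1 by simp
  also have "\<dots> = (w ^ q) ^ 2 - to_ac t * w ^ q + to_ac n"
    by (simp add: add diff power_mult_distrib tn flip: power_mult) (simp add: mult.commute)
  finally have w': "(w ^ q) ^ 2 - to_ac t * w ^ q + to_ac n = 0" by simp
  have "(w ^ q - w) * (w ^ q + w - to_ac t) =
      ((w ^ q) ^ 2 - to_ac t * w ^ q + to_ac n) - (w ^ 2 - to_ac t * w + to_ac n)"
    by (simp add: power2_eq_square algebra_simps)
  hence "(w ^ q - w) * (w ^ q + w - to_ac t) = 0" by (simp only: w w' diff_self)
  hence "w ^ q - w = 0 \<or> w ^ q + w - to_ac t = 0" by (simp only: mult_eq_0_iff)
  hence "w ^ q = w \<or> w ^ q = to_ac t - w" by (auto simp: algebra_simps)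
  hence "(w ^ q) ^ q = w"
    using diff[of "to_ac t" w] tn by auto
  hence ww: "w ^ CARD('a) = w" by (simp add: card_K power2_eq_square power_mult)
  let ?P = "monom 1 (CARD('a)) - monom 1 1 :: 'a alg_closure poly"
  have c: "CARD('a) > 1" using card_K q_gt_1 by (simp add: power2_eq_square one_less_mult)
  have "coeff ?P (CARD('a)) = 1" using c by simp
  hence nz: "?P \<noteq> 0" by (metis coeff_0 zero_neq_one)
  have "degree ?P \<le> CARD('a)"
    using c by (intro degree_diff_le order.trans[OF degree_monom_le]) auto
  hence le: "card {x. poly ?P x = 0} \<le> CARD('a)" and fin: "finite {x. poly ?P x = 0}"
    using card_poly_roots_bound[OF nz] poly_roots_finite[OF nz] by auto
  \<comment> \<open>X^(q^2) - X has at most q^2 roots, and the embedded field already provides that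
    many.\<close>
  have "range (to_ac :: 'a \<Rightarrow> _) \<subseteq> {x. poly ?P x = 0}"
    using finite_field_power_card_eq_same by (auto simp: poly_monom simp flip: to_ac_power)
  moreover have "card (range (to_ac :: 'a \<Rightarrow> 'a alg_closure)) = CARD('a)"
    by (rule card_image) (rule inj_to_ac)
  ultimately have "range (to_ac :: 'a \<Rightarrow> _) = {x. poly ?P x = 0}"
    using le by (intro card_seteq[OF fin]) simp_all
  moreover have "w \<in> {x. poly ?P x = 0}" using ww by (simp add: poly_monom)
  ultimately obtain x where "w = to_ac x" by auto
  with w have "to_ac (x ^ 2 - t * x + n) = 0" by simp
  thus ?thesis by (auto simp only: to_ac_eq_0_iff)
qed

section \<open>Power sums and Moebius maps on \<open>mu\<close>\<close>

lemma power_mu_cong: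
  assumes "x \<in> mu" "[r = n] (mod (q + 1))"
  shows "x ^ r = x ^ n"
proof -
  have "x ^ m = x ^ (m mod (q + 1))" for m
  proof -
    have "x ^ m = x ^ ((q + 1) * (m div (q + 1)) + m mod (q + 1))"
      unfolding mult_div_mod_eq ..
    also have "\<dots> = x ^ (m mod (q + 1))"
      using assms(1) unfolding mu_iff_power power_add power_mult by simp
    finally show ?thesis .
  qed
  thus ?thesis using assms(2) unfolding cong_def by metis
qed

text \<open>Multiplication by \<open>w\<close> permutes \<open>mu\<close> and scales the sum by w^n.
  The bound \<open>n \<le> q\<close> is what yields some \<open>w\<close> with w^n different from
  1.\<close>

lemma sum_mu_power:
  assumes "0 < n" "n \<le> q"
  shows "(\<Sum>z\<in>mu. z ^ n) = 0"
proof -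
  obtain w where w: "w \<in> mu" "w ^ n \<noteq> 1"
    using ex_power_neq_1[of n mu] assms card_mu by auto
  have "bij_betw (\<lambda>z. w * z) mu mu"
    using w(1) mu_mult mu_divide[OF _ w(1)]
    by (intro bij_betwI[where g = "\<lambda>z. z / w"]) (auto simp: mu_iff)
  hence "(\<Sum>z\<in>mu. z ^ n) = (\<Sum>z\<in>mu. (w * z) ^ n)"
    by (rule sum.reindex_bij_betw[symmetric])
  also have "\<dots> = w ^ n * (\<Sum>z\<in>mu. z ^ n)"
    by (simp add: power_mult_distrib sum_distrib_left)
  finally show ?thesis using w(2) by simp
qed

lemma linear_no_root_mu:
  assumes "u0 * cj u0 \<noteq> u1 * cj u1" "z \<in> mu"
  shows "u0 * z + u1 \<noteq> 0"
proof
  assume "u0 * z + u1 = 0"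
  hence "u1 = - u0 * z" by (simp add: eq_neg_iff_add_eq_0 add.commute)
  hence "u1 * cj u1 = u0 * cj u0 * (z * cj z)" by simp
  with assms show False by (simp add: mu_def)
qed

text \<open>On \<open>mu\<close> the numerator is \<open>z\<close> times the conjugate of the
  denominator, and the quotient of a conjugate by its element has norm one.\<close>

lemma moebius_mu:
  assumes "z \<in> mu" "e1 + e2 * z \<noteq> 0"
  shows "(cj e1 * z + cj e2) / (e1 + e2 * z) \<in> mu"
proof -
  have "z * cj (e1 + e2 * z) = cj e1 * z + cj e2 * (z * cj z)"
    by (simp only: cj_add cj_mult distrib_left mult_ac)
  hence "cj e1 * z + cj e2 = z * cj (e1 + e2 * z)"
    using assms(1) unfolding mu_def by simp
  hence "(cj e1 * z + cj e2) / (e1 + e2 * z) = z * (cj (e1 + e2 * z) / (e1 + e2 * z))"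
    by (simp only: times_divide_eq_right)
  also have "\<dots> \<in> mu"
    by (rule mu_mult[OF assms(1) cj_div_self_mu[OF assms(2)]])
  finally show ?thesis .
qed

text \<open>
  Writing \<open>S n\<close> for the sum of \<open>z ^ n / (e1 + e2 * z)\<close> over \<^term>\<open>mu\<close>, the relation
  \<open>e1 * S n + e2 * S (n + 1) = \<Sum>z\<in>mu. z ^ n\<close> makes \<open>S 1, \<dots>, S (q + 1)\<close> a geometric
  progression that cannot vanish; but the values of a permutation of \<^term>\<open>mu\<close> sum to zero.
\<close>

lemma power_times_moebius_not_inj:
  assumes ne: "e1 * cj e1 \<noteq> e2 * cj e2" and nz: "e1 \<noteq> 0" "e2 \<noteq> 0"
    and n: "\<not> (q + 1) dvd n"
  shows "\<not> inj_on (\<lambda>z. z ^ n * ((cj e1 * z + cj e2) / (e1 + e2 * z))) mu"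
proof
  define f where "f = (\<lambda>z. z ^ n * ((cj e1 * z + cj e2) / (e1 + e2 * z)))"
  assume "inj_on (\<lambda>z. z ^ n * ((cj e1 * z + cj e2) / (e1 + e2 * z))) mu"
  hence inj: "inj_on f mu" unfolding f_def .
  have den: "e1 + e2 * z \<noteq> 0" if "z \<in> mu" for z
    using linear_no_root_mu[OF ne[symmetric] that] by (metis add.commute)
  have "f z \<in> mu" if "z \<in> mu" for z
    unfolding f_def by (rule mu_mult[OF mu_power[OF that] moebius_mu[OF that den[OF that]]])
  hence "f ` mu = mu" using inj by (intro endo_inj_surj) auto
  hence "(\<Sum>z\<in>mu. f z) = (\<Sum>z\<in>mu. z)"
    using sum.reindex[OF inj, of "\<lambda>z. z"] by simp
  also have "\<dots> = 0" using sum_mu_power[of 1] q_gt_1 by simp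
  finally have sum0: "(\<Sum>z\<in>mu. f z) = 0" .
  define g where "g z = 1 / (e1 + e2 * z)" for z
  have g: "g z * (e1 + e2 * z) = 1" if "z \<in> mu" for z
    using den[OF that] by (simp add: g_def)
  have fg: "f z = z ^ n * ((cj e1 * z + cj e2) * g z)" for z
    by (simp add: f_def g_def)
  define S where "S j = (\<Sum>z\<in>mu. z ^ j * g z)" for j
  have rec: "e1 * S j + e2 * S (Suc j) = (\<Sum>z\<in>mu. z ^ j)" for j
  proof -
    have "e1 * S j + e2 * S (Suc j) = (\<Sum>z\<in>mu. z ^ j * (g z * (e1 + e2 * z)))"
      unfolding S_def sum_distrib_left sum.distrib[symmetric]
      by (intro sum.cong refl) (simp add: algebra_simps)
    also have "\<dots> = (\<Sum>z\<in>mu. z ^ j)"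
      by (intro sum.cong refl) (simp only: g mult_1_right)
    finally show ?thesis .
  qed
  have step: "S (Suc j) = - (e1 / e2) * S j" if "0 < j" "j \<le> q" for j
  proof -
    have "e2 * S (Suc j) = - (e1 * S j)"
      using rec[of j] sum_mu_power[OF that] by (simp add: eq_neg_iff_add_eq_0 add.commute)
    hence "e2 * S (Suc j) / e2 = - (e1 * S j) / e2" by simp
    thus ?thesis using nz(2) by simp
  qed
  \<comment> \<open>If it vanished, the progression would give \<open>S (q + 1) = 0\<close>, and
    periodicity \<open>S (q + 2) = 0\<close>; the relation at exponent q+1 would then read 0 = q+1,
    which is 1 in characteristic \<open>p\<close>.\<close>
  have "S (Suc 0) \<noteq> 0"
  proof
    assume S1: "S (Suc 0) = 0"
    have "S (Suc j) = 0" if "j \<le> q" for j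
      using that by (induction j) (simp_all add: S1 step)
    hence "S (q + 1) = 0" by simp
    moreover have "S (Suc (q + 1)) = S (Suc 0)"
      unfolding S_def
      by (intro sum.cong refl) (simp only: power_Suc[of _ "q + 1"] mu_iff_power power_one_right One_nat_def[symmetric] mult_1_right)
    moreover have "(\<Sum>z\<in>mu. z ^ (q + 1)) = (\<Sum>z\<in>mu. 1)"
      by (intro sum.cong refl) (simp only: mu_iff_power)
    moreover have "(of_nat q :: 'a) = 0"
      using CHAR_eq k_pos q_def by (simp add: of_nat_eq_0_iff_char_dvd)
    ultimately show False using rec[of "q + 1"] S1 card_mu by simp
  qed
  hence Snz: "S (Suc j) \<noteq> 0" if "j \<le> q" for j
    using that nz by (induction j) (simp_all add: step)
  \<comment> \<open>The reduced exponent lies in 1, ..., q, the range in which the progression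
    relation holds.\<close>
  define m where "m = n mod (q + 1)"
  have "m \<noteq> 0" using n unfolding m_def dvd_eq_mod_eq_0 .
  moreover have "m < q + 1" unfolding m_def by (rule mod_less_divisor) simp
  ultimately have m: "0 < m" "m \<le> q" by auto
  have pow: "z ^ n = z ^ m" if "z \<in> mu" for z
    using power_mu_cong[OF that] by (simp add: m_def)
  have "(\<Sum>z\<in>mu. f z) = cj e1 * S (Suc m) + cj e2 * S m"
    unfolding S_def sum_distrib_left sum.distrib[symmetric] fg
    by (intro sum.cong refl) (simp add: pow algebra_simps)
  \<comment> \<open>Substituting the progression leaves a difference of norms, nonzero by
    \<open>ne\<close>.\<close>
  also have "\<dots> = S m * ((cj e2 * e2 - cj e1 * e1) / e2)"
    unfolding step[OF m] using nz by (simp add: diff_divide_distrib algebra_simps)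
  finally have "S m * ((cj e2 * e2 - cj e1 * e1) / e2) = 0" using sum0 by simp
  moreover have "S m \<noteq> 0" using Snz[of "m - 1"] m by simp
  ultimately show False using ne nz by (simp add: mult.commute)
qed


section \<open>From permutations of the field to injectivity on \<open>mu\<close>\<close>

text \<open>
  On \<^term>\<open>mu\<close>, where \<open>cj x = 1 / x\<close>, this is the conjugate reciprocal \<open>A~\<close> of a polynomial
  function of degree at most \<open>n\<close>.
\<close>

definition tw :: "nat \<Rightarrow> ('a \<Rightarrow> 'a) \<Rightarrow> 'a \<Rightarrow> 'a" where
  "tw n F x = x ^ n * cj (F x)"

text \<open>
  The second condition is injectivity of \<open>tw n F / F\<close> on \<^term>\<open>mu\<close>; cross-multiplying makes it
  manifestly invariant under linear changes of the pair \<open>(F, tw n F)\<close>.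
\<close>

definition admissible :: "nat \<Rightarrow> ('a \<Rightarrow> 'a) \<Rightarrow> bool" where
  "admissible n F \<longleftrightarrow> (\<forall>x\<in>mu. F x \<noteq> 0) \<and>
     (\<forall>x\<in>mu. \<forall>y\<in>mu. tw n F x * F y = tw n F y * F x \<longrightarrow> x = y)"

lemma admissible_cong:
  "(\<And>x. x \<in> mu \<Longrightarrow> F x = G x) \<Longrightarrow> admissible n F = admissible n G"
  by (simp add: admissible_def tw_def)

lemma tw_tw: "x \<in> mu \<Longrightarrow> tw n (tw n F) x = F x"
  by (simp add: tw_def mu_iff power_one_over)

lemma fixed_nonzero_iff: "x ^ (q - 1) = 1 \<longleftrightarrow> x \<noteq> 0 \<and> cj x = x"
proof -
  have "cj x = x ^ (q - 1) * x" using power_minus_mult[of q x] q_gt_1 by (simp add: cj_def)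
  moreover have "x ^ (q - 1) = 0" if "x = 0" using that q_gt_1 by simp
  ultimately show ?thesis by (metis mult_cancel_right1 zero_neq_one)
qed

lemma card_fixed_nonzero: "card {x::'a. x ^ (q - 1) = 1} = q - 1"
proof -
  have "{x::'a. x ^ (q - 1) = 1} = {x. cj x = x} - {0}" unfolding fixed_nonzero_iff by auto
  thus ?thesis using card_fixed by (simp add: card_Diff_singleton)
qed

lemma inj_on_power_fixed: "inj_on (\<lambda>x::'a. x ^ n) {x. x ^ (q - 1) = 1} \<longleftrightarrow> coprime n (q - 1)"
  using card_fixed_nonzero q_gt_1 by (intro inj_on_power_iff) auto

lemma inj_on_power_mu: "inj_on (\<lambda>x. x ^ n) mu \<longleftrightarrow> coprime n (q + 1)"
  using card_mu by (intro inj_on_power_iff) (auto simp: mu_iff_power)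

text \<open>The fibres of x -> x^(q-1) on nonzero elements are the cosets of F_q^*. Within a coset f
  scales by w^r, which is injective iff \<open>r\<close> is coprime to q-1. Between cosets,
  f(x1)/f(x2) lies in F_q^* exactly when cj f / f, which is \<open>tw n F / F\<close> at y =
  x^(q-1), agrees at the two points. Zeros of \<open>F\<close> would collide with f(0) = 0.\<close>

lemma bij_iff_admissible:
  assumes r: "r > 0" "[r = n] (mod (q + 1))"
  shows "bij (\<lambda>x. x ^ r * F (x ^ (q - 1))) \<longleftrightarrow> coprime r (q - 1) \<and> admissible n F"
proof -
  define f where "f x = x ^ r * F (x ^ (q - 1))" for x
  have mu: "x ^ (q - 1) \<in> mu" if "x \<noteq> 0" for x
    using that image_power_mu by auto
  have cjx: "cj x = x ^ (q - 1) * x" for x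
    using power_minus_mult[of q x] q_gt_1 by (simp add: cj_def)
  have cjf: "cj (f x) = x ^ r * tw n F (x ^ (q - 1))" if "x \<noteq> 0" for x
  proof -
    have "cj (f x) = x ^ r * ((x ^ (q - 1)) ^ r * cj (F (x ^ (q - 1))))"
      unfolding f_def cj_mult cj_power[of x] cjx[of x] by (simp only: power_mult_distrib mult_ac)
    thus ?thesis by (simp only: tw_def power_mu_cong[OF mu[OF that] r(2)])
  qed
  have f0: "f 0 = 0" using r by (simp add: f_def)
  have "bij f \<longleftrightarrow> inj f" by (metis bij_def finite_UNIV_inj_surj finite)
  also have "\<dots> \<longleftrightarrow> coprime r (q - 1) \<and> admissible n F"
  proof
    assume inj: "inj f"
    have "inj_on (\<lambda>x::'a. x ^ r) {x. x ^ (q - 1) = 1}"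
    proof (rule inj_onI)
      fix x y :: 'a
      assume "x \<in> {x. x ^ (q - 1) = 1}" "y \<in> {x. x ^ (q - 1) = 1}" "x ^ r = y ^ r"
      hence "f x = f y" by (simp add: f_def)
      with inj show "x = y" by (rule injD)
    qed
    hence cop: "coprime r (q - 1)" by (simp only: inj_on_power_fixed)
    have nz: "F y \<noteq> 0" if "y \<in> mu" for y
    proof
      assume "F y = 0"
      from that obtain x where x: "x \<noteq> 0" "y = x ^ (q - 1)" using image_power_mu by auto
      hence "f x = f 0" using \<open>F y = 0\<close> f0 by (simp add: f_def)
      with inj x show False by (auto dest: injD)
    qed
    have "y1 = y2" if y: "y1 \<in> mu" "y2 \<in> mu" "tw n F y1 * F y2 = tw n F y2 * F y1" for y1 y2
    proof -
      obtain x1 where x1: "x1 \<noteq> 0" "y1 = x1 ^ (q - 1)" using image_power_mu y by auto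
      obtain x2 where x2: "x2 \<noteq> 0" "y2 = x2 ^ (q - 1)" using image_power_mu y by auto
      have fnz: "f x1 \<noteq> 0" "f x2 \<noteq> 0" using x1 x2 nz y by (auto simp: f_def)
      have "cj (f x1) * f x2 = cj (f x2) * f x1"
        unfolding cjf[OF x1(1)] cjf[OF x2(1)]
        using y(3) unfolding f_def x1(2) x2(2) by (simp add: algebra_simps)
      hence "cj (f x1 / f x2) = f x1 / f x2" using fnz by (simp add: field_simps)
      hence z: "f x1 / f x2 \<in> {x. x ^ (q - 1) = 1}" using fnz unfolding fixed_nonzero_iff by simp
      \<comment> \<open>Coprimality makes the r-th power map surjective on F_q^*, so the ratio of
        the two values is w^r, and \<open>w * x2\<close> has the same image as
        \<open>x1\<close>.\<close>
      have "(x ^ r) ^ (q - 1) = (x ^ (q - 1)) ^ r" for x :: 'a by (metis power_mult mult.commute)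
      hence "(\<lambda>x::'a. x ^ r) ` {x. x ^ (q - 1) = 1} \<subseteq> {x. x ^ (q - 1) = 1}" by auto
      hence "(\<lambda>x::'a. x ^ r) ` {x. x ^ (q - 1) = 1} = {x. x ^ (q - 1) = 1}"
        using cop unfolding inj_on_power_fixed[symmetric] by (intro endo_inj_surj) auto
      with z obtain w where w: "w ^ (q - 1) = 1" "f x1 / f x2 = w ^ r" by blast
      have "(w * x2) ^ (q - 1) = x2 ^ (q - 1)" by (simp only: power_mult_distrib w(1) mult_1_left)
      hence "f (w * x2) = w ^ r * f x2" 
        unfolding f_def \<open>(w * x2) ^ (q - 1) = x2 ^ (q - 1)\<close> by (simp only: power_mult_distrib mult_ac)
      also have "\<dots> = f x1" using fnz by (simp add: w(2)[symmetric])
      finally have "w * x2 = x1" using inj by (auto dest: injD)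
      thus ?thesis using \<open>(w * x2) ^ (q - 1) = x2 ^ (q - 1)\<close> x1 x2 by simp
    qed
    thus "coprime r (q - 1) \<and> admissible n F" using cop nz by (auto simp: admissible_def)
  next
    assume *: "coprime r (q - 1) \<and> admissible n F"
    have fnz: "f x \<noteq> 0" if "x \<noteq> 0" for x
      using * mu[OF that] that by (auto simp: f_def admissible_def)
    have "x1 = x2" if eq: "f x1 = f x2" and nz: "x1 \<noteq> 0" "x2 \<noteq> 0" for x1 x2
    proof -
      let ?y1 = "x1 ^ (q - 1)" and ?y2 = "x2 ^ (q - 1)"
      have "cj (f x1) * f x2 = cj (f x2) * f x1" using eq by simp
      hence "(x1 ^ r * x2 ^ r) * (tw n F ?y1 * F ?y2) = (x1 ^ r * x2 ^ r) * (tw n F ?y2 * F ?y1)"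
        unfolding cjf[OF nz(1)] cjf[OF nz(2)] by (simp only: f_def mult_ac)
      hence "tw n F ?y1 * F ?y2 = tw n F ?y2 * F ?y1" using nz by simp
      hence y: "?y1 = ?y2" using * mu nz by (auto simp: admissible_def)
      have "x1 ^ r * F ?y2 = x2 ^ r * F ?y2" using eq unfolding f_def y .
      moreover have "F ?y2 \<noteq> 0" using * mu nz by (auto simp: admissible_def)
      ultimately have "x1 ^ r = x2 ^ r" by simp
      with y * nz show ?thesis using power_cancel_coprime by blast
    qed
    thus "inj f" using fnz f0 by (metis injI)
  qed
  finally show ?thesis by (simp add: f_def[abs_def])
qed

lemma admissible_scale:
  assumes F: "admissible n F" and c: "\<gamma> \<in> mu" "\<delta> \<noteq> 0"
  shows "admissible n (\<lambda>x. \<delta> * F (\<gamma> * x))"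
proof -
  have tw: "tw n (\<lambda>x. \<delta> * F (\<gamma> * x)) x = cj \<delta> / \<gamma> ^ n * tw n F (\<gamma> * x)" for x
    using c by (simp add: tw_def mu_iff power_mult_distrib)
  show ?thesis
    unfolding admissible_def tw
  proof (intro conjI ballI impI)
    fix x assume "x \<in> mu"
    thus "\<delta> * F (\<gamma> * x) \<noteq> 0" using F c mu_mult by (auto simp: admissible_def)
  next
    fix x y assume xy: "x \<in> mu" "y \<in> mu"
      "cj \<delta> / \<gamma> ^ n * tw n F (\<gamma> * x) * (\<delta> * F (\<gamma> * y)) = cj \<delta> / \<gamma> ^ n * tw n F (\<gamma> * y) * (\<delta> * F (\<gamma> * x))"
    define e where "e = cj \<delta> / \<gamma> ^ n * \<delta>"
    have "e * (tw n F (\<gamma> * x) * F (\<gamma> * y)) = e * (tw n F (\<gamma> * y) * F (\<gamma> * x))"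
      using xy(3) unfolding e_def by (simp only: mult_ac)
    moreover have "e \<noteq> 0" using c by (auto simp: e_def mu_iff)
    ultimately have "tw n F (\<gamma> * x) * F (\<gamma> * y) = tw n F (\<gamma> * y) * F (\<gamma> * x)" by simp
    hence "\<gamma> * x = \<gamma> * y"
      using F mu_mult[OF c(1) xy(1)] mu_mult[OF c(1) xy(2)] unfolding admissible_def by blast
    thus "x = y" using c by (auto simp: mu_iff)
  qed
qed

text \<open>The pair \<open>(F, tw n F)\<close> arises from \<open>(B, tw n B)\<close> by the matrix
  with rows (e, f) and (cj f, cj e). Cross products are multiplied by its determinant, the
  difference of the norms of \<open>e\<close> and \<open>f\<close>.\<close>

lemma admissible_combine:
  assumes "e * cj e \<noteq> f * cj f"
  shows "admissible n (\<lambda>x. e * B x + f * tw n B x) \<longleftrightarrow> admissible n B"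
proof -
  define F where "F x = e * B x + f * tw n B x" for x
  have twF: "tw n F x = cj e * tw n B x + cj f * B x" if "x \<in> mu" for x
  proof -
    have "tw n F x = cj e * tw n B x + cj f * tw n (tw n B) x"
      unfolding tw_def F_def by (simp add: algebra_simps)
    thus ?thesis by (simp only: tw_tw[OF that])
  qed
  have zero: "F x = 0 \<longleftrightarrow> B x = 0" if x: "x \<in> mu" for x
  proof
    assume "F x = 0"
    hence "tw n F x = 0" by (simp add: tw_def)
    have "(e * cj e - f * cj f) * B x = cj e * F x - f * tw n F x"
      using twF[OF x] by (simp add: F_def algebra_simps)
    also have "\<dots> = 0" using \<open>F x = 0\<close> \<open>tw n F x = 0\<close> by simp
    finally show "B x = 0" using assms by simp
  next
    assume "B x = 0"
    thus "F x = 0" by (simp add: F_def tw_def)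
  qed
  have cross: "tw n F x * F y - tw n F y * F x =
      (e * cj e - f * cj f) * (tw n B x * B y - tw n B y * B x)" if "x \<in> mu" "y \<in> mu" for x y
    unfolding twF[OF that(1)] twF[OF that(2)] by (simp add: F_def algebra_simps)
  have "tw n F x * F y = tw n F y * F x \<longleftrightarrow> tw n B x * B y = tw n B y * B x"
    if "x \<in> mu" "y \<in> mu" for x y
    using cross[OF that] assms by (metis eq_iff_diff_eq_0 mult_eq_0_iff)
  with zero have "admissible n F \<longleftrightarrow> admissible n B" by (simp add: admissible_def)
  thus ?thesis by (simp add: F_def[abs_def])
qed

text \<open>The common factor \<open>w\<close> cancels from cross products, leaving
  \<open>N / D\<close> composed with a permutation of \<open>mu\<close>.\<close>

lemma admissible_reparam:
  assumes z: "bij_betw z mu mu"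
    and B: "\<And>x. x \<in> mu \<Longrightarrow> B x = w x * D (z x)" "\<And>x. x \<in> mu \<Longrightarrow> tw n B x = w x * N (z x)"
    and nz: "\<And>x. x \<in> mu \<Longrightarrow> w x \<noteq> 0" "\<And>x. x \<in> mu \<Longrightarrow> D x \<noteq> 0"
  shows "admissible n B \<longleftrightarrow> inj_on (\<lambda>t. N t / D t) mu"
proof -
  have zmu: "z x \<in> mu" if "x \<in> mu" for x using that z by (auto simp: bij_betw_def)
  have cross: "tw n B x * B y = tw n B y * B x \<longleftrightarrow> N (z x) / D (z x) = N (z y) / D (z y)"
    if "x \<in> mu" "y \<in> mu" for x y
  proof -
    have "tw n B x * B y = tw n B y * B x \<longleftrightarrow>
        (w x * w y) * (N (z x) * D (z y)) = (w x * w y) * (N (z y) * D (z x))"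
      unfolding B(1)[OF that(1)] B(1)[OF that(2)] B(2)[OF that(1)] B(2)[OF that(2)]
      by (simp only: mult_ac)
    also have "\<dots> \<longleftrightarrow> N (z x) * D (z y) = N (z y) * D (z x)"
      using nz that by simp
    finally show ?thesis using nz zmu that by (simp add: frac_eq_eq)
  qed
  have "admissible n B \<longleftrightarrow> (\<forall>x\<in>mu. \<forall>y\<in>mu. N (z x) / D (z x) = N (z y) / D (z y) \<longrightarrow> x = y)"
    using cross B nz zmu by (auto simp: admissible_def)
  also have "\<dots> \<longleftrightarrow> (\<forall>x\<in>mu. \<forall>y\<in>mu. N (z x) / D (z x) = N (z y) / D (z y) \<longrightarrow> z x = z y)"
    using z by (auto simp: bij_betw_def inj_on_def)
  also have "\<dots> \<longleftrightarrow> (\<forall>t\<in>z ` mu. \<forall>s\<in>z ` mu. N t / D t = N s / D s \<longrightarrow> t = s)" by blast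
  also have "z ` mu = mu" using z by (simp add: bij_betw_def)
  finally show ?thesis by (simp add: inj_on_def)
qed

end

section \<open>Bilinear forms in x and x^Q\<close>

locale quadratic_field_frobenius = quadratic_finite_field K p k q
  for K :: "'a::finite_field itself" and p k q :: nat +
  fixes l Q :: nat
  assumes l_pos: "l > 0" and Q_def: "Q = p ^ l"
begin

lemma Q_add: "(x + y :: 'a) ^ Q = x ^ Q + y ^ Q"
  and Q_diff: "(x - y :: 'a) ^ Q = x ^ Q - y ^ Q"
  and Q_minus: "(- x :: 'a) ^ Q = - (x ^ Q)"
  and Q_mu_iff: "x ^ Q \<in> mu \<longleftrightarrow> x \<in> mu"
  unfolding Q_def by (rule frob_add frob_diff frob_minus mu_frob_iff)+

lemma Q_root: "\<exists>y::'a. y ^ Q = x"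
  unfolding Q_def by (rule frob_root)

lemma Q_pos: "Q > 0"
  using prime_gt_0_nat[OF prime_p] by (simp add: Q_def)

text \<open>q+1 is 1 modulo \<open>p\<close>, hence coprime to every power of \<open>p\<close>. This
  meets the exponent condition of \<open>power_times_moebius_not_inj\<close>.\<close>

lemma not_dvd_Q: "\<not> (q + 1) dvd Q"
proof
  assume "(q + 1) dvd Q"
  moreover have "coprime (q + 1) p"
  proof -
    have "p dvd q" using k_pos by (simp add: q_def)
    hence "coprime (q + 1) p" using prime_p
      by (metis coprime_commute dvd_add_right_iff not_prime_unit prime_imp_coprime)
    thus ?thesis .
  qed
  ultimately have "is_unit (q + 1)"
    unfolding Q_def by (metis coprime_absorb_left coprime_power_right_iff)
  thus False using q_gt_1 by simp
qed

text \<open>Additivity of the Q-power map gives this in every characteristic, including 2, where Q+1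
  is odd but -1 = 1.\<close>

lemma even_power_Suc_Q: "(- 1 :: 'a) ^ (Q + 1) = 1"
  by (simp add: Q_minus)

text \<open>A bilinear form in (x, 1) and (x^Q, 1) with determinant
  \<open>a * d - b * c\<close>.\<close>

definition form :: "'a \<Rightarrow> 'a \<Rightarrow> 'a \<Rightarrow> 'a \<Rightarrow> 'a \<Rightarrow> 'a" where
  "form a b c d x = a * x ^ (Q + 1) + b * x ^ Q + c * x + d"

lemma tw_form:
  assumes "x \<in> mu"
  shows "tw (Q + 1) (form a b c d) x = form (cj d) (cj c) (cj b) (cj a) x"
proof -
  have x: "x * cj x = 1" using assms by (simp add: mu_def)
  have xQ: "x ^ Q * cj x ^ Q = 1" by (simp add: x flip: power_mult_distrib)
  have "tw (Q + 1) (form a b c d) x = cj a * ((x * cj x) * (x ^ Q * cj x ^ Q)) + cj b * x * (x ^ Q * cj x ^ Q)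
      + cj c * x ^ Q * (x * cj x) + cj d * x ^ (Q + 1)"
    by (simp add: tw_def form_def algebra_simps)
  thus ?thesis unfolding x xQ by (simp add: form_def algebra_simps)
qed

text \<open>A singular 2 by 2 matrix is an outer product; Q-th roots of one factor put it in the
  shape that \<open>form_rank_one\<close> multiplies out.\<close>

lemma rank_one:
  assumes "a * d = b * (c :: 'a)"
  shows "\<exists>u0 u1 v0 v1. a = u0 * v0 ^ Q \<and> b = u1 * v0 ^ Q \<and> c = u0 * v1 ^ Q \<and> d = u1 * v1 ^ Q"
proof -
  have "\<exists>u0 u1 w0 w1. a = u0 * w0 \<and> b = u1 * w0 \<and> c = u0 * w1 \<and> d = u1 * w1"
  proof (cases "a = 0 \<and> b = 0")
    case True
    thus ?thesis by (intro exI[of _ c] exI[of _ d] exI[of _ 0] exI[of _ 1]) simp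
  next
    case False
    show ?thesis
    proof (cases "a = 0")
      case True
      with False assms have "b \<noteq> 0" "c = 0" by auto
      thus ?thesis using True by (intro exI[of _ 0] exI[of _ b] exI[of _ 1] exI[of _ "d / b"]) simp
    next
      case False
      thus ?thesis using assms
        by (intro exI[of _ a] exI[of _ b] exI[of _ 1] exI[of _ "c / a"]) (simp add: field_simps)
    qed
  qed
  then obtain u0 u1 w0 w1 where
    "a = u0 * w0" "b = u1 * w0" "c = u0 * w1" "d = u1 * w1" by blast
  moreover obtain v0 v1 where "v0 ^ Q = w0" "v1 ^ Q = w1" using Q_root by metis
  ultimately show ?thesis by blast
qed

lemma form_rank_one:
  "form (u0 * v0 ^ Q) (u1 * v0 ^ Q) (u0 * v1 ^ Q) (u1 * v1 ^ Q) x = (u0 * x + u1) * (v0 * x + v1) ^ Q"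
  by (simp add: form_def Q_add power_mult_distrib algebra_simps)

lemma admissible_form_nz: "admissible (Q + 1) (form a b c d) \<Longrightarrow> x \<in> mu \<Longrightarrow> form a b c d x \<noteq> 0"
  by (simp add: admissible_def)

lemma linear_root_mu:
  assumes "u0 * cj u0 = u1 * cj u1"
  shows "\<exists>x\<in>mu. u0 * x + u1 = 0"
proof (cases "u0 = 0")
  case True
  thus ?thesis using assms by (intro bexI[of _ 1]) auto
next
  case False
  hence "- u1 / u0 \<in> mu" using assms norm_eq_mu[of "- u1" u0] by simp
  thus ?thesis using False by (intro bexI[of _ "- u1 / u0"]) auto
qed

text \<open>The numerator is \<open>x\<close> times the conjugate of the denominator, so
  \<open>mu\<close> is preserved; the determinant of the Moebius map is a difference of norms, so it
  is injective.\<close>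

lemma bij_betw_ratio:
  assumes "v0 * cj v0 \<noteq> v1 * cj v1"
  shows "bij_betw (\<lambda>x. (cj v1 * x + cj v0) / (v0 * x + v1)) mu mu"
proof -
  let ?z = "\<lambda>x. (cj v1 * x + cj v0) / (v0 * x + v1)"
  have nz: "v0 * x + v1 \<noteq> 0" if "x \<in> mu" for x
    using linear_no_root_mu[OF assms that] .
  have "?z x \<in> mu" if "x \<in> mu" for x
    using moebius_mu[OF that, of v1 v0] nz[OF that] by (simp add: add.commute)
  hence sub: "?z ` mu \<subseteq> mu" by auto
  have inj: "inj_on ?z mu"
  proof (rule inj_onI)
    fix x y assume xy: "x \<in> mu" "y \<in> mu" "?z x = ?z y"
    hence "(cj v1 * x + cj v0) * (v0 * y + v1) = (cj v1 * y + cj v0) * (v0 * x + v1)"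
      using nz by (simp add: frac_eq_eq)
    moreover have "(cj v1 * x + cj v0) * (v0 * y + v1) - (cj v1 * y + cj v0) * (v0 * x + v1)
        = (v1 * cj v1 - v0 * cj v0) * (x - y)"
      by (simp add: algebra_simps)
    ultimately show "x = y" using assms by simp
  qed
  show ?thesis using inj endo_inj_surj[OF _ sub inj] by (simp add: bij_betw_def)
qed

text \<open>Conjugate reciprocals exchange v and v~. Taking out v^(Q+1) therefore leaves e1 + e2 z
  in the coordinate z = v~/v and z^Q (cj e1 z + cj e2) for its companion.\<close>

lemma admissible_pencil:
  assumes v: "v0 * cj v0 \<noteq> v1 * cj v1" and e: "e1 * cj e1 \<noteq> e2 * cj e2"
  shows "admissible (Q + 1)
      (\<lambda>x. (e1 * (v0 * x + v1) + e2 * (cj v1 * x + cj v0)) * (v0 * x + v1) ^ Q) \<longleftrightarrow>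
    inj_on (\<lambda>z. z ^ Q * ((cj e1 * z + cj e2) / (e1 + e2 * z))) mu"
proof -
  define v where "v x = v0 * x + v1" for x
  define vt where "vt x = cj v1 * x + cj v0" for x
  define z where "z x = vt x / v x" for x
  have nz: "v x \<noteq> 0" if "x \<in> mu" for x
    using linear_no_root_mu[OF v that] by (simp add: v_def)
  have vt: "vt x = v x * z x" if "x \<in> mu" for x using nz[OF that] by (simp add: z_def)
  have cv: "x * cj (v x) = vt x" "x * cj (vt x) = v x" if "x \<in> mu" for x
    using that by (simp_all add: v_def vt_def mu_iff distrib_left)
  have "admissible (Q + 1) (\<lambda>x. (e1 * v x + e2 * vt x) * v x ^ Q) \<longleftrightarrow>
      inj_on (\<lambda>t. t ^ Q * (cj e1 * t + cj e2) / (e1 + e2 * t)) mu"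
  proof (rule admissible_reparam[where z = z and w = "\<lambda>x. v x ^ (Q + 1)"])
    show "bij_betw z mu mu"
      using bij_betw_ratio[OF v] by (simp add: z_def[abs_def] vt_def v_def)
  next
    fix x assume x: "x \<in> mu"
    show "(e1 * v x + e2 * vt x) * v x ^ Q = v x ^ (Q + 1) * (e1 + e2 * z x)"
      unfolding vt[OF x] by (simp add: algebra_simps)
    have "tw (Q + 1) (\<lambda>x. (e1 * v x + e2 * vt x) * v x ^ Q) x =
        (cj e1 * (x * cj (v x)) + cj e2 * (x * cj (vt x))) * (x * cj (v x)) ^ Q"
      by (simp add: tw_def power_mult_distrib algebra_simps)
    also have "\<dots> = (cj e1 * (v x * z x) + cj e2 * v x) * (v x * z x) ^ Q"
      unfolding cv[OF x] by (simp only: vt[OF x])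
    also have "\<dots> = v x ^ (Q + 1) * (z x ^ Q * (cj e1 * z x + cj e2))"
      by (simp add: power_mult_distrib algebra_simps)
    finally show "tw (Q + 1) (\<lambda>x. (e1 * v x + e2 * vt x) * v x ^ Q) x = \<dots>" .
    show "v x ^ (Q + 1) \<noteq> 0" using nz[OF x] by simp
    show "e1 + e2 * x \<noteq> 0"
      using linear_no_root_mu[OF e[symmetric] x] by (simp add: add.commute)
  qed
  thus ?thesis by (simp add: v_def vt_def)
qed

lemma inj_power_Suc_Q: "inj_on (\<lambda>z. z ^ (Q + 1)) mu \<longleftrightarrow> p = 2 \<and> multiplicity 2 k \<noteq> multiplicity 2 l"
  unfolding inj_on_power_mu unfolding q_def Q_def
  by (rule coprime_prime_power_plus_plus[OF prime_p k_pos l_pos])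

lemma inj_power_Q_div: "inj_on (\<lambda>z. z ^ Q / z) mu \<longleftrightarrow> p = 2 \<and> multiplicity 2 l \<le> multiplicity 2 k"
proof -
  have "z ^ Q / z = z ^ (Q - 1)" if "z \<in> mu" for z
    using power_minus_mult[OF Q_pos, of z] that by (auto simp: mu_iff divide_eq_eq)
  hence "inj_on (\<lambda>z. z ^ Q / z) mu \<longleftrightarrow> inj_on (\<lambda>z. z ^ (Q - 1)) mu"
    by (rule inj_on_cong)
  also have "\<dots> \<longleftrightarrow> coprime (q + 1) (Q - 1)"
    unfolding inj_on_power_mu by (rule coprime_commute)
  finally show ?thesis unfolding q_def Q_def
    \<comment> \<open>\<open>k\<close> and \<open>l\<close> are interchanged, which reverses the
      inequality of multiplicities.\<close>
    using coprime_prime_power_plus_minus[OF prime_p l_pos k_pos] by simp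
qed

lemma pencil_cases:
  assumes v: "v0 * cj v0 \<noteq> v1 * cj v1" and e: "e1 * cj e1 \<noteq> e2 * cj e2"
    and adm: "admissible (Q + 1)
      (\<lambda>x. (e1 * (v0 * x + v1) + e2 * (cj v1 * x + cj v0)) * (v0 * x + v1) ^ Q)"
  shows "e2 = 0 \<and> p = 2 \<and> multiplicity 2 k \<noteq> multiplicity 2 l \<or>
         e1 = 0 \<and> p = 2 \<and> multiplicity 2 l \<le> multiplicity 2 k"
proof -
  let ?f = "\<lambda>z. z ^ Q * ((cj e1 * z + cj e2) / (e1 + e2 * z))"
  have inj: "inj_on ?f mu" using adm unfolding admissible_pencil[OF v e] .
  hence "e1 = 0 \<or> e2 = 0" using power_times_moebius_not_inj[OF e _ _ not_dvd_Q] by blast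
  thus ?thesis
  proof
    assume "e2 = 0"
    hence "e1 \<noteq> 0" using e by auto
    hence "inj_on (\<lambda>z. z ^ (Q + 1)) mu"
      using inj \<open>e2 = 0\<close> by (simp add: inj_on_def mult.commute)
    thus ?thesis using \<open>e2 = 0\<close> unfolding inj_power_Suc_Q by simp
  next
    assume "e1 = 0"
    hence "e2 \<noteq> 0" using e by auto
    have f: "?f z = (cj e2 / e2) * (z ^ Q / z)" for z using \<open>e1 = 0\<close> by simp
    have "inj_on (\<lambda>z. z ^ Q / z) mu"
    proof (rule inj_onI)
      fix x y assume "x \<in> mu" "y \<in> mu" "x ^ Q / x = y ^ Q / y"
      moreover from this(3) have "?f x = ?f y" by (simp only: f)
      ultimately show "x = y" using inj by (simp only: inj_on_def)
    qed
    thus ?thesis using \<open>e1 = 0\<close> unfolding inj_power_Q_div by simp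
  qed
qed


text \<open>Both summands U and V equal their own conjugate reciprocals, so for \<beta> outside F_q
  the condition is injectivity of U/V = T^(Q+1), where T = (\<alpha> x - cj \<alpha>)/(x - 1)
  carries \<open>mu\<close> to the projective line over F_q with 1 going to infinity.\<close>

lemma admissible_rational_pencil:
  assumes \<alpha>: "cj \<alpha> \<noteq> \<alpha>"
  shows "admissible (Q + 1) (\<lambda>x. (\<alpha> * x - cj \<alpha>) ^ (Q + 1) + \<beta> * (x - 1) ^ (Q + 1)) \<longleftrightarrow>
    cj \<beta> \<noteq> \<beta> \<and> p = 2 \<and> multiplicity 2 k \<le> multiplicity 2 l"
proof -
  define U where "U x = (\<alpha> * x - cj \<alpha>) ^ (Q + 1)" for x
  define V where "V x = (x - 1) ^ (Q + 1)" for x :: 'a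
  define F where "F x = U x + \<beta> * V x" for x
  have UV: "U x \<noteq> 0 \<or> V x \<noteq> 0" for x using \<alpha> by (auto simp: U_def V_def)
  have twU: "tw (Q + 1) U x = U x" and twV: "tw (Q + 1) V x = V x" if x: "x \<in> mu" for x
  proof -
    \<comment> \<open>Each linear factor is only reproduced up to sign; the power Q+1 removes the
      sign.\<close>
    have "x * cj (\<alpha> * x - cj \<alpha>) = (- 1) * (\<alpha> * x - cj \<alpha>)" "x * cj (x - 1) = (- 1) * (x - 1)"
      using x by (simp_all add: mu_iff algebra_simps)
    thus "tw (Q + 1) U x = U x" "tw (Q + 1) V x = V x"
      unfolding tw_def U_def V_def cj_power
      by (simp_all only: power_mult_distrib[symmetric]) (simp_all only: power_mult_distrib even_power_Suc_Q mult_1_left)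
  qed
  have twF: "tw (Q + 1) F x = U x + cj \<beta> * V x" if x: "x \<in> mu" for x
  proof -
    have "tw (Q + 1) F x = tw (Q + 1) U x + cj \<beta> * tw (Q + 1) V x"
      by (simp add: tw_def F_def algebra_simps)
    thus ?thesis by (simp only: twU[OF x] twV[OF x])
  qed
  have cross: "tw (Q + 1) F x * F y - tw (Q + 1) F y * F x = (\<beta> - cj \<beta>) * (U x * V y - V x * U y)"
    if "x \<in> mu" "y \<in> mu" for x y
    unfolding twF[OF that(1)] twF[OF that(2)] F_def by (simp add: algebra_simps)
  have Fnz: "F x \<noteq> 0" if "x \<in> mu" "cj \<beta> \<noteq> \<beta>" for x
  proof
    assume "F x = 0"
    hence "tw (Q + 1) F x = 0" by (simp add: tw_def)
    have "(\<beta> - cj \<beta>) * V x = F x - tw (Q + 1) F x"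
      unfolding twF[OF that(1)] F_def by (simp add: algebra_simps)
    hence "V x = 0" using \<open>F x = 0\<close> \<open>tw (Q + 1) F x = 0\<close> that by simp
    with \<open>F x = 0\<close> UV[of x] show False by (simp add: F_def)
  qed
  have 1: "admissible (Q + 1) F \<longleftrightarrow>
      cj \<beta> \<noteq> \<beta> \<and> (\<forall>x\<in>mu. \<forall>y\<in>mu. U x * V y = V x * U y \<longrightarrow> x = y)" (is "_ \<longleftrightarrow> _ \<and> ?inj")
  proof (cases "cj \<beta> = \<beta>")
    case True
    \<comment> \<open>For \<beta> in F_q the quotient is constantly 1, so any second point of
      \<open>mu\<close> refutes injectivity.\<close>
    obtain x where "x \<in> mu" "x \<noteq> 1" using ex_mu_neq_1 by auto
    moreover have "tw (Q + 1) F x * F 1 = tw (Q + 1) F 1 * F x"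
      using cross[OF \<open>x \<in> mu\<close> one_in_mu] True by simp
    ultimately show ?thesis using True one_in_mu unfolding admissible_def by blast
  next
    case False
    have "tw (Q + 1) F x * F y = tw (Q + 1) F y * F x \<longleftrightarrow> U x * V y = V x * U y"
      if "x \<in> mu" "y \<in> mu" for x y
      using cross[OF that] False by (metis eq_iff_diff_eq_0 mult_eq_0_iff)
    thus ?thesis using False Fnz unfolding admissible_def by auto
  qed
  have 2: "?inj \<longleftrightarrow> inj_on (\<lambda>t::'a. t ^ (Q + 1)) {t. t ^ (q - 1) = 1}"
  proof
    assume inj: ?inj
    show "inj_on (\<lambda>t::'a. t ^ (Q + 1)) {t. t ^ (q - 1) = 1}"
    proof (rule inj_onI)
      fix t s :: 'a
      assume "t \<in> {t. t ^ (q - 1) = 1}" "s \<in> {t. t ^ (q - 1) = 1}" and eq: "t ^ (Q + 1) = s ^ (Q + 1)"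
      hence ts: "cj t = t" "cj s = s" unfolding mem_Collect_eq fixed_nonzero_iff by auto
      \<comment> \<open>\<open>pt\<close> inverts T on F_q, and \<open>h t\<close> is the common
        factor of \<alpha> x - cj \<alpha> and x - 1 at x = \<open>pt t\<close>, their ratio being
        t.\<close>
      define pt where "pt t = (t - cj \<alpha>) / (t - \<alpha>)" for t
      define h where "h t = (\<alpha> - cj \<alpha>) / (t - \<alpha>)" for t
      have nz: "t - \<alpha> \<noteq> 0" if "cj t = t" for t using that \<alpha> by auto
      have ptmu: "pt t \<in> mu" if "cj t = t" for t
        using cj_div_self_mu[OF nz[OF that]] that by (simp add: pt_def)
      have Upt: "U (pt t) = h t ^ (Q + 1) * t ^ (Q + 1)" and Vpt: "V (pt t) = h t ^ (Q + 1)"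
        if "cj t = t" for t
      proof -
        have "\<alpha> * pt t - cj \<alpha> = h t * t" "pt t - 1 = h t"
          using nz[OF that] by (simp_all add: pt_def h_def field_simps)
        thus "U (pt t) = h t ^ (Q + 1) * t ^ (Q + 1)" "V (pt t) = h t ^ (Q + 1)"
          unfolding U_def V_def by (simp_all only: power_mult_distrib)
      qed
      have "U (pt t) * V (pt s) = V (pt t) * U (pt s)"
        unfolding Upt[OF ts(1)] Upt[OF ts(2)] Vpt[OF ts(1)] Vpt[OF ts(2)] eq by (simp only: mult_ac)
      hence "pt t = pt s" using inj ptmu ts by blast
      hence "(t - cj \<alpha>) * (s - \<alpha>) = (s - cj \<alpha>) * (t - \<alpha>)"
        using nz ts by (simp add: pt_def frac_eq_eq)
      moreover have "(t - cj \<alpha>) * (s - \<alpha>) - (s - cj \<alpha>) * (t - \<alpha>) = (cj \<alpha> - \<alpha>) * (t - s)"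
        by (simp add: algebra_simps)
      ultimately show "t = s" using \<alpha> by simp
    qed
  next
    assume "inj_on (\<lambda>t::'a. t ^ (Q + 1)) {t. t ^ (q - 1) = 1}"
    hence cop: "coprime (Q + 1) (q - 1)" unfolding inj_on_power_fixed .
    show ?inj
    proof (intro ballI impI)
      fix x y assume xy: "x \<in> mu" "y \<in> mu" and eq: "U x * V y = V x * U y"
      have V0: "V x = 0 \<longleftrightarrow> x = 1" for x by (auto simp: V_def)
      show "x = y"
      \<comment> \<open>The point at infinity: V vanishes only at 1, and U does not vanish with
        it.\<close>
      proof (cases "x = 1 \<or> y = 1")
        case True
        thus ?thesis using eq V0 UV by (metis mult_eq_0_iff)
      next
        case False
        define T where "T x = (\<alpha> * x - cj \<alpha>) / (x - 1)" for x
        have T: "cj (T x) = T x" if "x \<in> mu" "x \<noteq> 1" for x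
        proof -
          have "x * cj (\<alpha> * x - cj \<alpha>) = - (\<alpha> * x - cj \<alpha>)" "x * cj (x - 1) = - (x - 1)"
            using that by (simp_all add: mu_iff algebra_simps)
          moreover have "cj (T x) = (x * cj (\<alpha> * x - cj \<alpha>)) / (x * cj (x - 1))"
            using that unfolding T_def cj_divide by (simp add: mu_iff)
          ultimately show ?thesis unfolding T_def by (simp only: minus_divide_divide)
        qed
        have "T x ^ (Q + 1) = U x / V x" for x
          by (simp only: T_def U_def V_def power_divide)
        moreover have "U x / V x = U y / V y"
          using False V0 eq by (simp add: frac_eq_eq mult.commute)
        ultimately have TQ: "T x ^ (Q + 1) = T y ^ (Q + 1)" by simp
        have "T x = T y"
        proof (cases "T y = 0")
          case True
          thus ?thesis using TQ by auto
        next
          case Ty: False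
          with TQ have "T x \<noteq> 0" by auto
          with Ty T xy False have "T x ^ (q - 1) = 1" "T y ^ (q - 1) = 1"
            unfolding fixed_nonzero_iff by auto
          thus ?thesis using power_cancel_coprime[OF cop TQ _ Ty] by simp
        qed
        hence "(\<alpha> * x - cj \<alpha>) * (y - 1) = (\<alpha> * y - cj \<alpha>) * (x - 1)"
          using False by (simp add: T_def frac_eq_eq)
        moreover have "(\<alpha> * x - cj \<alpha>) * (y - 1) - (\<alpha> * y - cj \<alpha>) * (x - 1) = (cj \<alpha> - \<alpha>) * (x - y)"
          by (simp add: algebra_simps)
        ultimately show ?thesis using \<alpha> by simp
      qed
    qed
  qed
  have "coprime (Q + 1) (q - 1) \<longleftrightarrow> p = 2 \<and> multiplicity 2 k \<le> multiplicity 2 l"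
    unfolding q_def Q_def by (rule coprime_prime_power_plus_minus[OF prime_p k_pos l_pos])
  thus ?thesis using 1 2 unfolding inj_on_power_fixed F_def[abs_def] U_def V_def by simp
qed

section \<open>Degenerate members of the pencil A~ - yA\<close>

text \<open>
  Hypothesis \<open>det\<close> says that the bilinear form \<open>A~ - y A\<close> in \<open>x\<close> and \<open>x ^ Q\<close> is degenerate, so
  that it factors.
\<close>

lemma pencil_root_mu:
  assumes adm: "admissible (Q + 1) (form a b c d)" and y: "y \<in> mu"
    and det: "(cj d - y * a) * (cj a - y * d) = (cj c - y * b) * (cj b - y * c)"
  obtains x1 e where "x1 \<in> mu" "e \<noteq> 0" "cj d = y * a + e" "cj c = y * b - e * x1"
    "cj b = y * c - e * x1 ^ Q" "cj a = y * d + e * x1 ^ (Q + 1)"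
proof -
  define a' b' c' d' where defs: "a' = cj d - y * a" "b' = cj c - y * b"
    "c' = cj b - y * c" "d' = cj a - y * d"
  have det': "a' * d' = b' * c'" using det by (simp add: defs)
  have y0: "y \<noteq> 0" "cj y = 1 / y" using y by (auto simp: mu_iff)
  \<comment> \<open>For \<open>y\<close> in \<open>mu\<close> the form A~ - yA is -y times its own
    conjugate reciprocal; degeneracy then says that \<open>a'\<close> and \<open>b'\<close> have
    equal norm, which places its zeros in \<open>mu\<close>.\<close>
  have d': "d' = - y * cj a'" and c': "c' = - y * cj b'"
    using y0 by (simp_all add: defs algebra_simps)
  have tw: "tw (Q + 1) (form a b c d) x = y * form a b c d x + form a' b' c' d' x" if "x \<in> mu" for x
    unfolding tw_form[OF that] by (simp add: form_def defs algebra_simps)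
  \<comment> \<open>Otherwise all four coefficients vanish and A~/A is constant on
    \<open>mu\<close>.\<close>
  have a'0: "a' \<noteq> 0"
  proof
    assume "a' = 0"
    with det' d' c' y0 have "b' = 0" by auto
    hence "tw (Q + 1) (form a b c d) x = y * form a b c d x" if "x \<in> mu" for x
      unfolding tw[OF that] c' d' using \<open>a' = 0\<close> by (simp add: form_def)
    hence "tw (Q + 1) (form a b c d) x * form a b c d 1 =
        tw (Q + 1) (form a b c d) 1 * form a b c d x" if "x \<in> mu" for x
      using that by (simp only: one_in_mu mult_ac)
    hence "x = 1" if "x \<in> mu" for x
      using adm that one_in_mu unfolding admissible_def by blast
    thus False using ex_mu_neq_1 by blast
  qed
  define x1 where "x1 = - b' / a'"
  have "a' * cj a' = b' * cj b'" using det' d' c' y0 by simp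
  hence x1: "x1 \<in> mu" using norm_eq_mu[of "- b'" a'] a'0 by (simp add: x1_def)
  obtain x2 where x2Q: "x2 ^ Q = - c' / a'" using Q_root by blast
  have "c' * cj c' = a' * cj a'"
    using \<open>a' * cj a' = b' * cj b'\<close> y0 unfolding c' by simp
  hence "x2 ^ Q \<in> mu" unfolding x2Q using norm_eq_mu[of "- c'" a'] a'0 by simp
  hence x2: "x2 \<in> mu" unfolding Q_mu_iff .
  have b'e: "b' = - a' * x1" using a'0 by (simp add: x1_def)
  have c'e: "c' = - a' * x2 ^ Q" using a'0 by (simp add: x2Q)
  have d'e: "d' = a' * x1 * x2 ^ Q" using det' a'0 unfolding b'e c'e by simp
  have "form a' b' c' d' x = a' * (x - x1) * (x - x2) ^ Q" for x
    unfolding b'e c'e d'e by (simp add: form_def Q_diff algebra_simps)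
  hence "form a' b' c' d' x1 = 0" "form a' b' c' d' x2 = 0" using Q_pos by simp_all
  hence "tw (Q + 1) (form a b c d) x1 * form a b c d x2 = tw (Q + 1) (form a b c d) x2 * form a b c d x1"
    unfolding tw[OF x1] tw[OF x2] by simp
  hence "x1 = x2" using adm x1 x2 by (auto simp: admissible_def)
  show thesis
  proof (rule that[OF x1 a'0])
    show "cj d = y * a + a'" by (simp add: defs)
    have "cj c = y * b + b'" by (simp add: defs)
    thus "cj c = y * b - a' * x1" by (simp add: b'e)
    have "cj b = y * c + c'" by (simp add: defs)
    thus "cj b = y * c - a' * x1 ^ Q" by (simp add: c'e \<open>x1 = x2\<close>)
    have "cj a = y * d + d'" by (simp add: defs)
    thus "cj a = y * d + a' * x1 ^ (Q + 1)" by (simp add: d'e \<open>x1 = x2\<close>)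
  qed
qed

text \<open>The outer coefficients are conjugate to each other and the middle one is fixed by
  \<open>cj\<close>: the self-reciprocity of h used for its roots.\<close>

lemma pencil_det:
  "(cj d - y * a) * (cj a - y * d) - (cj c - y * b) * (cj b - y * c) =
    (a * d - b * c) * y ^ 2 - (a * cj a + d * cj d - b * cj b - c * cj c) * y + cj (a * d - b * c)"
  by (simp add: power2_eq_square algebra_simps)

text \<open>The roots of h multiply to cj D / D, an element of \<open>mu\<close>, so a root in
  \<open>mu\<close> has its partner there. Eliminating A~ between A~ = yA + e (x - x1)^(Q+1) and the
  same relation for y' expresses A through the two powers.\<close>

lemma pencil_two_roots:
  assumes adm: "admissible (Q + 1) (form a b c d)" and y: "y \<in> mu"
    and det: "(cj d - y * a) * (cj a - y * d) = (cj c - y * b) * (cj b - y * c)"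
  obtains e1 e2 x1 x2 where "x1 \<in> mu" "x2 \<in> mu" "x1 \<noteq> x2" "e1 \<noteq> 0" "a = e1 + e2"
    "b = - (e1 * x1 + e2 * x2)" "c = - (e1 * x1 ^ Q + e2 * x2 ^ Q)"
    "d = e1 * x1 ^ (Q + 1) + e2 * x2 ^ (Q + 1)"
proof -
  obtain x1 e where 1: "x1 \<in> mu" "e \<noteq> 0" "cj d = y * a + e" "cj c = y * b - e * x1"
    "cj b = y * c - e * x1 ^ Q" "cj a = y * d + e * x1 ^ (Q + 1)"
    using pencil_root_mu[OF assms] .
  define D T where DT: "D = a * d - b * c" "T = a * cj a + d * cj d - b * cj b - c * cj c"
  have h: "(cj d - y * a) * (cj a - y * d) = (cj c - y * b) * (cj b - y * c) \<longleftrightarrow>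
      D * y ^ 2 - T * y + cj D = 0" for y
    unfolding DT pencil_det[symmetric] by simp
  have hy: "D * y ^ 2 - T * y + cj D = 0" using det unfolding h .
  have y0: "y \<noteq> 0" "cj y = 1 / y" using y by (auto simp: mu_iff)
  have "\<exists>y'\<in>mu. y' \<noteq> y \<and> D * y' ^ 2 - T * y' + cj D = 0"
  proof (cases "D = 0")
    case True
    \<comment> \<open>With D = 0 the polynomial h vanishes identically, so any other element of
      \<open>mu\<close> can be the second root.\<close>
    with hy y0 have "T = 0" by simp
    obtain z where z: "z \<in> mu" "z \<noteq> 1" using ex_mu_neq_1 by auto
    hence "y * z \<in> mu" "y * z \<noteq> y" using mu_mult[OF y] y0 by auto
    thus ?thesis using True \<open>T = 0\<close> by (intro bexI[of _ "y * z"]) auto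
  next
    case False
    define y' where "y' = cj D / D / y"
    have "y' \<in> mu" unfolding y'_def by (rule mu_divide[OF cj_div_self_mu[OF False] y])
    have Dy: "D * y * y' = cj D" using False y0 by (simp add: y'_def)
    have "y * (D * y' ^ 2 - T * y' + cj D) = y' * (D * y * y') - T * y * y' + y * cj D"
      by (simp add: power2_eq_square algebra_simps)
    also have "\<dots> = y' * (D * y ^ 2 - T * y + cj D)"
      unfolding Dy by (simp add: Dy[symmetric] power2_eq_square algebra_simps)
    also have "\<dots> = 0" unfolding hy by simp
    finally have "D * y' ^ 2 - T * y' + cj D = 0" using y0(1) by (simp only: mult_eq_0_iff simp_thms)
    moreover have "y' \<noteq> y"
    proof
      assume "y' = y"
      hence "D * y * y = cj D" using Dy by simp
      \<comment> \<open>A double root makes D y^2 = cj D, and this identity then turns it into a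
        zero of A on \<open>mu\<close>.\<close>
      have "y * e * form a b c d x1 = cj D - D * y * y"
        unfolding DT cj_diff cj_mult 1(3-6) by (simp add: form_def algebra_simps)
      also have "\<dots> = 0" using \<open>D * y * y = cj D\<close> by simp
      finally show False using y0 1(2) admissible_form_nz[OF adm 1(1)] by simp
    qed
    ultimately show ?thesis using \<open>y' \<in> mu\<close> by blast
  qed
  then obtain y' where y': "y' \<in> mu" "y' \<noteq> y" and h': "D * y' ^ 2 - T * y' + cj D = 0" by blast
  have det': "(cj d - y' * a) * (cj a - y' * d) = (cj c - y' * b) * (cj b - y' * c)"
    using h' unfolding h .
  obtain x2 e' where 2: "x2 \<in> mu" "e' \<noteq> 0" "cj d = y' * a + e'" "cj c = y' * b - e' * x2"
    "cj b = y' * c - e' * x2 ^ Q" "cj a = y' * d + e' * x2 ^ (Q + 1)"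
    using pencil_root_mu[OF adm y'(1) det'] .
  define f where "f = y' - y"
  have f: "f \<noteq> 0" using y' by (simp add: f_def)
  have elim: "f * s = t - t'" if "w = y * s + t" "w = y' * s + t'" for s t t' w
  proof -
    have "f * s - (t - t') = (y' * s + t') - (y * s + t)" by (simp add: f_def algebra_simps)
    also have "\<dots> = 0" by (simp only: that[symmetric] diff_self)
    finally show ?thesis by simp
  qed
  have abcd: "f * a = e - e'" "f * b = e' * x2 - e * x1" "f * c = e' * x2 ^ Q - e * x1 ^ Q"
    "f * d = e * x1 ^ (Q + 1) - e' * x2 ^ (Q + 1)"
  proof -
    show "f * a = e - e'" by (rule elim[OF 1(3) 2(3)])
    have "f * b = - (e * x1) - - (e' * x2)"
      by (rule elim[OF 1(4)[unfolded diff_conv_add_uminus] 2(4)[unfolded diff_conv_add_uminus]])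
    thus "f * b = e' * x2 - e * x1" by simp
    have "f * c = - (e * x1 ^ Q) - - (e' * x2 ^ Q)"
      by (rule elim[OF 1(5)[unfolded diff_conv_add_uminus] 2(5)[unfolded diff_conv_add_uminus]])
    thus "f * c = e' * x2 ^ Q - e * x1 ^ Q" by simp
    show "f * d = e * x1 ^ (Q + 1) - e' * x2 ^ (Q + 1)" by (rule elim[OF 1(6) 2(6)])
  qed
  have "x1 \<noteq> x2"
  proof
    assume "x1 = x2"
    \<comment> \<open>A~/A is y at \<open>x1\<close> and y' at \<open>x2\<close>, so the points
      cannot coincide.\<close>
    have "tw (Q + 1) (form a b c d) x1 = y * form a b c d x1"
      unfolding tw_form[OF 1(1)] 1(3-6) by (simp add: form_def algebra_simps)
    moreover have "tw (Q + 1) (form a b c d) x2 = y' * form a b c d x2"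
      unfolding tw_form[OF 2(1)] 2(3-6) by (simp add: form_def algebra_simps)
    ultimately show False
      using \<open>x1 = x2\<close> y'(2) admissible_form_nz[OF adm 1(1)] by simp
  qed
  define e1 e2 where e12: "e1 = e / f" "e2 = - e' / f"
  have fe: "f * (e1 * s + e2 * t) = e * s - e' * t" for s t
  proof -
    have "f * (e1 * s + e2 * t) = (f * e1) * s + (f * e2) * t" by (simp only: distrib_left mult.assoc)
    moreover have "f * e1 = e" "f * e2 = - e'" using f by (simp_all add: e12)
    ultimately show ?thesis by simp
  qed
  note cancel = mult_left_cancel[OF f, THEN iffD1]
  show thesis
  proof (rule that[OF 1(1) 2(1) \<open>x1 \<noteq> x2\<close>])
    show "e1 \<noteq> 0" using f 1(2) by (simp add: e12)
    have "f * a = f * (e1 + e2)" using fe[of 1 1] abcd(1) by simp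
    thus "a = e1 + e2" by (rule cancel)
    show "b = - (e1 * x1 + e2 * x2)" "c = - (e1 * x1 ^ Q + e2 * x2 ^ Q)"
      by (rule cancel, simp only: fe abcd mult_minus_right minus_diff_eq)+
    show "d = e1 * x1 ^ (Q + 1) + e2 * x2 ^ (Q + 1)"
      by (rule cancel) (simp only: fe abcd)
  qed
qed

text \<open>In w = D y the quadratic has coefficients T and D cj D in F_q, so it splits. For such a
  root, B = A~ - yA factors, and B~ = A - (cj y) A~; eliminating A~ gives (1 - y cj y) A = (cj y) B
  + B~, solvable because y is outside \<open>mu\<close>.\<close>

lemma pencil_no_root_mu:
  assumes noroot: "\<And>y. y \<in> mu \<Longrightarrow>
    (cj d - y * a) * (cj a - y * d) \<noteq> (cj c - y * b) * (cj b - y * c)"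
  obtains e f u0 u1 v0 v1 where "e * cj e \<noteq> f * cj f"
    "a = e * (u0 * v0 ^ Q) + f * (cj u1 * cj v1 ^ Q)"
    "b = e * (u1 * v0 ^ Q) + f * (cj u0 * cj v1 ^ Q)"
    "c = e * (u0 * v1 ^ Q) + f * (cj u1 * cj v0 ^ Q)"
    "d = e * (u1 * v1 ^ Q) + f * (cj u0 * cj v0 ^ Q)"
proof -
  define D T where DT: "D = a * d - b * c" "T = a * cj a + d * cj d - b * cj b - c * cj c"
  show thesis
  proof (cases "D = 0")
    case True
    hence "a * d = b * c" by (simp add: DT)
    then obtain u0 u1 v0 v1 where
      "a = u0 * v0 ^ Q" "b = u1 * v0 ^ Q" "c = u0 * v1 ^ Q" "d = u1 * v1 ^ Q"
      using rank_one by blast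
    \<comment> \<open>A itself already factors, so B = A.\<close>
    thus thesis by (intro that[of 1 0 u0 v0 u1 v1]) simp_all
  next
    case False
    have "cj T = T" by (simp add: DT algebra_simps)
    moreover have "cj (D * cj D) = D * cj D" by (simp add: mult.commute)
    ultimately obtain w where w: "w ^ 2 - T * w + D * cj D = 0" using quadratic_splits by blast
    define y where "y = w / D"
    have "D * (D * y ^ 2 - T * y + cj D) = w ^ 2 - T * w + D * cj D"
      using False by (simp add: y_def power2_eq_square field_simps)
    hence "D * y ^ 2 - T * y + cj D = 0" using w False by simp
    hence det: "(cj d - y * a) * (cj a - y * d) = (cj c - y * b) * (cj b - y * c)"
      unfolding DT pencil_det[symmetric] by simp
    with noroot have "y \<notin> mu" by blast
    define n where "n = 1 - y * cj y"
    have n: "n \<noteq> 0" "cj n = n" using \<open>y \<notin> mu\<close> by (auto simp: n_def mu_def mult.commute)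
    obtain u0 u1 v0 v1 where uv: "cj d - y * a = u0 * v0 ^ Q" "cj c - y * b = u1 * v0 ^ Q"
      "cj b - y * c = u0 * v1 ^ Q" "cj a - y * d = u1 * v1 ^ Q"
      using rank_one[OF det] by blast
    have cuv: "cj (u0 * v0 ^ Q) = d - cj y * cj a" "cj (u1 * v0 ^ Q) = c - cj y * cj b"
      "cj (u0 * v1 ^ Q) = b - cj y * cj c" "cj (u1 * v1 ^ Q) = a - cj y * cj d"
      unfolding uv[symmetric] by simp_all
    have nx: "n * a = cj y * (u0 * v0 ^ Q) + cj (u1 * v1 ^ Q)"
      "n * b = cj y * (u1 * v0 ^ Q) + cj (u0 * v1 ^ Q)"
      "n * c = cj y * (u0 * v1 ^ Q) + cj (u1 * v0 ^ Q)"
      "n * d = cj y * (u1 * v1 ^ Q) + cj (u0 * v0 ^ Q)"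
      unfolding cuv uv[symmetric] by (simp_all add: n_def algebra_simps)
    show thesis
    proof (rule that)
      have "y * cj y \<noteq> 1" using n by (simp add: n_def)
      thus "cj y / n * cj (cj y / n) \<noteq> 1 / n * cj (1 / n)"
        using n by (simp add: field_simps)
      show "a = cj y / n * (u0 * v0 ^ Q) + 1 / n * (cj u1 * cj v1 ^ Q)"
        "b = cj y / n * (u1 * v0 ^ Q) + 1 / n * (cj u0 * cj v1 ^ Q)"
        "c = cj y / n * (u0 * v1 ^ Q) + 1 / n * (cj u1 * cj v0 ^ Q)"
        "d = cj y / n * (u1 * v1 ^ Q) + 1 / n * (cj u0 * cj v0 ^ Q)"
        using nx n by (simp_all add: field_simps)
    qed
  qed
qed


section \<open>The three normal forms are admissible\<close>

lemma power_q_Q: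
  "\<alpha> ^ (q + Q) = cj \<alpha> * \<alpha> ^ Q" "\<alpha> ^ (q * Q) = cj \<alpha> ^ Q"
  "\<alpha> ^ (q * Q + 1) = cj \<alpha> ^ Q * \<alpha>" "\<alpha> ^ (q * Q + q) = cj \<alpha> ^ (Q + 1)"
  by (simp_all only: cj_def power_add power_mult power_one_right)

text \<open>In characteristic 2 the parametrized cases are the expansions of (\<alpha> x - cj
  \<alpha>)^(Q+1) + \<beta> (x - 1)^(Q+1), then v^(Q+1) + \<beta> v~^(Q+1), then v~ v^Q + \<beta> v
  v~^Q, where v = (cj \<alpha>) x + 1 and v~ = x + \<alpha>.\<close>

definition normal_form :: "'a \<Rightarrow> 'a \<Rightarrow> 'a \<Rightarrow> 'a \<Rightarrow> bool" where
  "normal_form a b c d \<longleftrightarrow>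
    multiplicity 2 k \<le> multiplicity 2 l \<and>
      (\<exists>\<alpha> \<beta>. cj \<alpha> \<noteq> \<alpha> \<and> cj \<beta> \<noteq> \<beta> \<and>
        a = \<alpha> ^ (Q + 1) + \<beta> \<and> b = \<alpha> ^ (q + Q) + \<beta> \<and>
        c = \<alpha> ^ (q * Q + 1) + \<beta> \<and> d = \<alpha> ^ (q * Q + q) + \<beta>) \<or>
    multiplicity 2 k \<noteq> multiplicity 2 l \<and>
      (a = 1 \<and> b = 0 \<and> c = 0 \<and> d = 0 \<or>
       (\<exists>\<alpha> \<beta>. \<alpha> \<notin> mu \<and> \<beta> \<notin> mu \<and>
        a = \<alpha> ^ (q * Q + q) + \<beta> \<and> b = \<alpha> ^ (q * Q) + \<alpha> * \<beta> \<and>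
        c = \<alpha> ^ q + \<alpha> ^ Q * \<beta> \<and> d = 1 + \<alpha> ^ (Q + 1) * \<beta>)) \<or>
    multiplicity 2 k \<ge> multiplicity 2 l \<and>
      (a = 0 \<and> b = 1 \<and> c = 0 \<and> d = 0 \<or>
       (\<exists>\<alpha> \<beta>. \<alpha> \<notin> mu \<and> \<beta> \<notin> mu \<and>
        a = \<alpha> ^ (q * Q) + \<alpha> ^ q * \<beta> \<and> b = \<alpha> ^ (q * Q + 1) + \<beta> \<and>
        c = 1 + \<alpha> ^ (q + Q) * \<beta> \<and> d = \<alpha> + \<alpha> ^ Q * \<beta>))"

lemma minus_eq_self: "p = 2 \<Longrightarrow> - x = (x :: 'a)"
proof -
  assume "p = 2"
  hence "(of_nat 2 :: 'a) = 0" using CHAR_eq by (metis of_nat_CHAR)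
  hence "x + x = 0" by (metis mult_2 mult_zero_left of_nat_numeral)
  thus ?thesis by (metis add_eq_0_iff)
qed

text \<open>Here B = v^(Q+1) is the pencil member with e1 = 1, e2 = 0, and B~ = v~^(Q+1).\<close>

lemma admissible_Suc_Q:
  assumes v: "v0 * cj v0 \<noteq> v1 * cj v1" and e: "e * cj e \<noteq> f * cj f"
    and inj: "p = 2" "multiplicity 2 k \<noteq> multiplicity 2 l"
  shows "admissible (Q + 1)
    (\<lambda>x. e * (v0 * x + v1) ^ (Q + 1) + f * (cj v1 * x + cj v0) ^ (Q + 1))"
proof -
  let ?B = "\<lambda>x. (1 * (v0 * x + v1) + 0 * (cj v1 * x + cj v0)) * (v0 * x + v1) ^ Q"
  have "inj_on (\<lambda>z. z ^ (Q + 1)) mu" using inj inj_power_Suc_Q by simp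
  hence "admissible (Q + 1) ?B"
    by (subst admissible_pencil[OF v]) (simp_all add: mult.commute)
  hence "admissible (Q + 1) (\<lambda>x. e * ?B x + f * tw (Q + 1) ?B x)"
    by (rule iffD2[OF admissible_combine[OF e]])
  moreover have "e * ?B x + f * tw (Q + 1) ?B x =
      e * (v0 * x + v1) ^ (Q + 1) + f * (cj v1 * x + cj v0) ^ (Q + 1)" if "x \<in> mu" for x
  proof -
    have "x * cj (v0 * x + v1) = cj v1 * x + cj v0" using that by (simp add: mu_iff distrib_left)
    moreover have "tw (Q + 1) ?B x = (x * cj (v0 * x + v1)) ^ (Q + 1)"
      unfolding power_mult_distrib by (simp add: tw_def)
    ultimately show ?thesis by simp
  qed
  ultimately show ?thesis by (rule iffD1[OF admissible_cong, rotated])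
qed

text \<open>The other surviving member, e1 = 0, e2 = 1: B = v~ v^Q and B~ = v v~^Q.\<close>

lemma admissible_Q_minus:
  assumes v: "v0 * cj v0 \<noteq> v1 * cj v1" and e: "e * cj e \<noteq> f * cj f"
    and inj: "p = 2" "multiplicity 2 l \<le> multiplicity 2 k"
  shows "admissible (Q + 1)
    (\<lambda>x. e * ((cj v1 * x + cj v0) * (v0 * x + v1) ^ Q) + f * ((v0 * x + v1) * (cj v1 * x + cj v0) ^ Q))"
proof -
  let ?B = "\<lambda>x. (0 * (v0 * x + v1) + 1 * (cj v1 * x + cj v0)) * (v0 * x + v1) ^ Q"
  have "inj_on (\<lambda>z. z ^ Q / z) mu" using inj inj_power_Q_div by simp
  hence "admissible (Q + 1) ?B"
    by (subst admissible_pencil[OF v]) simp_all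
  hence "admissible (Q + 1) (\<lambda>x. e * ?B x + f * tw (Q + 1) ?B x)"
    by (rule iffD2[OF admissible_combine[OF e]])
  moreover have "e * ?B x + f * tw (Q + 1) ?B x =
      e * ((cj v1 * x + cj v0) * (v0 * x + v1) ^ Q) + f * ((v0 * x + v1) * (cj v1 * x + cj v0) ^ Q)"
    if "x \<in> mu" for x
  proof -
    have "x * cj (v0 * x + v1) = cj v1 * x + cj v0" "x * cj (cj v1 * x + cj v0) = v0 * x + v1"
      using that by (simp_all add: mu_iff distrib_left)
    moreover have "tw (Q + 1) ?B x = (x * cj (cj v1 * x + cj v0)) * (x * cj (v0 * x + v1)) ^ Q"
      unfolding power_mult_distrib by (simp add: tw_def)
    ultimately show ?thesis by simp
  qed
  ultimately show ?thesis by (rule iffD1[OF admissible_cong, rotated])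
qed

lemma admissible_normal_form:
  assumes p2: "p = 2" and nf: "normal_form a b c d"
  shows "admissible (Q + 1) (form a b c d)"
proof -
  note min = minus_eq_self[OF p2]
  from nf[unfolded normal_form_def power_q_Q cj_def[symmetric]] consider
    (1) \<alpha> \<beta> where "multiplicity 2 k \<le> multiplicity 2 l" "cj \<alpha> \<noteq> \<alpha>" "cj \<beta> \<noteq> \<beta>"
      "a = \<alpha> ^ (Q + 1) + \<beta>" "b = cj \<alpha> * \<alpha> ^ Q + \<beta>"
      "c = cj \<alpha> ^ Q * \<alpha> + \<beta>" "d = cj \<alpha> ^ (Q + 1) + \<beta>"
  | (2) "multiplicity 2 k \<noteq> multiplicity 2 l" "a = 1" "b = 0" "c = 0" "d = 0"
  | (3) \<alpha> \<beta> where "multiplicity 2 k \<noteq> multiplicity 2 l" "\<alpha> \<notin> mu" "\<beta> \<notin> mu"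
      "a = cj \<alpha> ^ (Q + 1) + \<beta>" "b = cj \<alpha> ^ Q + \<alpha> * \<beta>"
      "c = cj \<alpha> + \<alpha> ^ Q * \<beta>" "d = 1 + \<alpha> ^ (Q + 1) * \<beta>"
  | (4) "multiplicity 2 l \<le> multiplicity 2 k" "a = 0" "b = 1" "c = 0" "d = 0"
  | (5) \<alpha> \<beta> where "multiplicity 2 l \<le> multiplicity 2 k" "\<alpha> \<notin> mu" "\<beta> \<notin> mu"
      "a = cj \<alpha> ^ Q + cj \<alpha> * \<beta>" "b = cj \<alpha> ^ Q * \<alpha> + \<beta>"
      "c = 1 + cj \<alpha> * \<alpha> ^ Q * \<beta>" "d = \<alpha> + \<alpha> ^ Q * \<beta>"
    by blast
  thus ?thesis
  proof cases
    case 1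
    have "form a b c d x = (\<alpha> * x - cj \<alpha>) ^ (Q + 1) + \<beta> * (x - 1) ^ (Q + 1)" for x
      unfolding 1(4-7) diff_conv_add_uminus min
      by (simp add: form_def Q_add power_mult_distrib algebra_simps)
    hence F: "form a b c d = (\<lambda>x. (\<alpha> * x - cj \<alpha>) ^ (Q + 1) + \<beta> * (x - 1) ^ (Q + 1))" ..
    show ?thesis unfolding F admissible_rational_pencil[OF 1(2)] using 1(1,3) p2 by simp
  next
    case 2
    have "form a b c d x = 1 * (1 * x + 0) ^ (Q + 1) + 0 * (cj 0 * x + cj 1) ^ (Q + 1)" for x
      unfolding 2(2-5) by (simp add: form_def)
    hence "form a b c d = (\<lambda>x. 1 * (1 * x + 0) ^ (Q + 1) + 0 * (cj 0 * x + cj 1) ^ (Q + 1))" ..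
    thus ?thesis using admissible_Suc_Q[OF _ _ p2 2(1), of 1 0 1 0] by simp
  next
    case 3
    \<comment> \<open>With v0 = cj \<alpha>, v1 = 1, e = 1, f = \<beta>, the two norm inequalities
      say that \<alpha> and \<beta> lie outside \<open>mu\<close>.\<close>
    have "form a b c d x = 1 * (cj \<alpha> * x + 1) ^ (Q + 1) + \<beta> * (cj 1 * x + cj (cj \<alpha>)) ^ (Q + 1)" for x
      unfolding 3(4-7) by (simp add: form_def Q_add power_mult_distrib algebra_simps)
    hence "form a b c d = (\<lambda>x. 1 * (cj \<alpha> * x + 1) ^ (Q + 1) + \<beta> * (cj 1 * x + cj (cj \<alpha>)) ^ (Q + 1))" ..
    thus ?thesis using admissible_Suc_Q[OF _ _ p2 3(1), of "cj \<alpha>" 1 1 \<beta>] 3(2,3)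
      by (simp add: mu_def mult.commute eq_commute[of 1])
  next
    case 4
    have "form a b c d x = 1 * ((cj 0 * x + cj 1) * (1 * x + 0) ^ Q) + 0 * ((1 * x + 0) * (cj 0 * x + cj 1) ^ Q)" for x
      unfolding 4(2-5) by (simp add: form_def)
    hence "form a b c d = (\<lambda>x. 1 * ((cj 0 * x + cj 1) * (1 * x + 0) ^ Q) + 0 * ((1 * x + 0) * (cj 0 * x + cj 1) ^ Q))" ..
    thus ?thesis using admissible_Q_minus[OF _ _ p2 4(1), of 1 0 1 0] by simp
  next
    case 5
    have "form a b c d x = 1 * ((cj 1 * x + cj (cj \<alpha>)) * (cj \<alpha> * x + 1) ^ Q)
        + \<beta> * ((cj \<alpha> * x + 1) * (cj 1 * x + cj (cj \<alpha>)) ^ Q)" for x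
      unfolding 5(4-7) by (simp add: form_def Q_add power_mult_distrib algebra_simps)
    hence "form a b c d = (\<lambda>x. 1 * ((cj 1 * x + cj (cj \<alpha>)) * (cj \<alpha> * x + 1) ^ Q)
        + \<beta> * ((cj \<alpha> * x + 1) * (cj 1 * x + cj (cj \<alpha>)) ^ Q))" ..
    thus ?thesis using admissible_Q_minus[OF _ _ p2 5(1), of "cj \<alpha>" 1 1 \<beta>] 5(2,3)
      by (simp add: mu_def mult.commute eq_commute[of 1])
  qed
qed

definition equivalent_normal_form :: "'a \<Rightarrow> 'a \<Rightarrow> 'a \<Rightarrow> 'a \<Rightarrow> bool" where
  "equivalent_normal_form a b c d \<longleftrightarrow> (\<exists>\<gamma>\<in>mu. \<exists>\<delta>. \<delta> \<noteq> 0 \<and> (\<exists>a0 b0 c0 d0.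
     a = \<delta> * (a0 * \<gamma> ^ (Q + 1)) \<and> b = \<delta> * (b0 * \<gamma> ^ Q) \<and> c = \<delta> * (c0 * \<gamma>) \<and> d = \<delta> * d0 \<and>
     normal_form a0 b0 c0 d0))"

lemma equivalent_normal_formI:
  assumes "\<delta> \<noteq> 0" "normal_form a0 b0 c0 d0" "a = \<delta> * a0" "b = \<delta> * b0" "c = \<delta> * c0" "d = \<delta> * d0"
  shows "equivalent_normal_form a b c d"
  unfolding equivalent_normal_form_def using assms
  by (intro bexI[of _ 1] exI[of _ \<delta>] conjI exI[of _ a0] exI[of _ b0] exI[of _ c0] exI[of _ d0]) auto

lemma form_scale:
  "form (\<delta> * (a * \<gamma> ^ (Q + 1))) (\<delta> * (b * \<gamma> ^ Q)) (\<delta> * (c * \<gamma>)) (\<delta> * d) x = \<delta> * form a b c d (\<gamma> * x)"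
  by (simp add: form_def power_mult_distrib algebra_simps)

lemma admissible_equivalent_normal_form:
  assumes "p = 2" "equivalent_normal_form a b c d"
  shows "admissible (Q + 1) (form a b c d)"
proof -
  obtain \<gamma> \<delta> a0 b0 c0 d0 where *: "\<gamma> \<in> mu" "\<delta> \<noteq> 0" "normal_form a0 b0 c0 d0"
    "a = \<delta> * (a0 * \<gamma> ^ (Q + 1))" "b = \<delta> * (b0 * \<gamma> ^ Q)" "c = \<delta> * (c0 * \<gamma>)" "d = \<delta> * d0"
    using assms(2) unfolding equivalent_normal_form_def by blast
  have "form a b c d = (\<lambda>x. \<delta> * form a0 b0 c0 d0 (\<gamma> * x))"
    unfolding *(4-7) by (rule ext) (rule form_scale)
  thus ?thesis using admissible_scale[OF admissible_normal_form[OF assms(1) *(3)] *(1,2)] by simp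
qed

section \<open>Bringing admissible forms into normal form\<close>

lemma ratio_notin_mu:
  assumes "x * cj x \<noteq> y * cj y" "y \<noteq> 0"
  shows "x / y \<notin> mu"
  using assms by (simp add: mu_def divide_simps)

text \<open>Rescaling by \<gamma> = 1/x2 moves \<open>x2\<close> to 1. Hilbert 90 writes the image
  x1/x2 of the other point as cj \<alpha> / \<alpha>, the zero of \<alpha> x - cj \<alpha>; \<delta>
  and \<beta> are then read off from \<open>e1\<close> and \<open>e2\<close>.\<close>

lemma normalize_rational_pencil:
  assumes adm: "admissible (Q + 1) (form a b c d)"
    and x: "x1 \<in> mu" "x2 \<in> mu" "x1 \<noteq> x2" and e1: "e1 \<noteq> 0"
    and abcd: "a = e1 + e2" "b = - (e1 * x1 + e2 * x2)" "c = - (e1 * x1 ^ Q + e2 * x2 ^ Q)"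
      "d = e1 * x1 ^ (Q + 1) + e2 * x2 ^ (Q + 1)"
  shows "p = 2 \<and> equivalent_normal_form a b c d"
proof -
  obtain \<alpha> where \<alpha>: "\<alpha> \<noteq> 0" "cj \<alpha> = x1 / x2 * \<alpha>" using hilbert90 mu_divide x by blast
  have x0: "x1 \<noteq> 0" "x2 \<noteq> 0" using x by (auto simp: mu_iff)
  have c\<alpha>: "cj \<alpha> \<noteq> \<alpha>" using \<alpha> x(3) x0 by (simp add: divide_eq_eq)
  define \<gamma> where "\<gamma> = 1 / x2"
  have \<gamma>: "\<gamma> \<in> mu" "\<gamma> * x2 = 1" "\<gamma> \<noteq> 0" using x(2) x0 mu_divide[of 1 x2] by (auto simp: \<gamma>_def)
  have c\<alpha>e: "cj \<alpha> = x1 * \<gamma> * \<alpha>" using \<alpha> by (simp add: \<gamma>_def)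
  define \<delta> where "\<delta> = e1 / (\<alpha> * \<gamma>) ^ (Q + 1)"
  define \<beta> where "\<beta> = e2 / (\<delta> * \<gamma> ^ (Q + 1))"
  have \<delta>: "\<delta> \<noteq> 0" using e1 \<alpha> \<gamma> by (simp add: \<delta>_def)
  have e1e: "e1 = \<delta> * \<alpha> ^ (Q + 1) * \<gamma> ^ (Q + 1)" using \<alpha> \<gamma> by (simp add: \<delta>_def power_mult_distrib)
  have e2e: "e2 = \<delta> * \<beta> * \<gamma> ^ (Q + 1)" using \<delta> \<gamma> by (simp add: \<beta>_def)
  have x2e: "\<gamma> * x2 = 1" "\<gamma> ^ Q * x2 ^ Q = 1"
    using \<gamma>(2) by (simp_all flip: power_mult_distrib)
  define a0 b0 c0 d0 where defs: "a0 = \<alpha> ^ (Q + 1) + \<beta>" "b0 = cj \<alpha> * \<alpha> ^ Q + \<beta>"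
    "c0 = cj \<alpha> ^ Q * \<alpha> + \<beta>" "d0 = cj \<alpha> ^ (Q + 1) + \<beta>"
  have a: "a = \<delta> * (a0 * \<gamma> ^ (Q + 1))"
    unfolding abcd e1e e2e defs by (simp add: algebra_simps)
  have b: "b = \<delta> * (- b0 * \<gamma> ^ Q)"
  proof -
    have "b = - (\<delta> * \<gamma> ^ Q * ((x1 * \<gamma> * \<alpha>) * \<alpha> ^ Q + \<beta> * (\<gamma> * x2)))"
      unfolding abcd e1e e2e by (simp add: algebra_simps)
    thus ?thesis unfolding x2e c\<alpha>e[symmetric] defs by (simp add: algebra_simps)
  qed
  have c: "c = \<delta> * (- c0 * \<gamma>)"
  proof -
    have "c = - (\<delta> * \<gamma> * ((x1 * \<gamma> * \<alpha>) ^ Q * \<alpha> + \<beta> * (\<gamma> ^ Q * x2 ^ Q)))"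
      unfolding abcd e1e e2e by (simp add: power_mult_distrib algebra_simps)
    thus ?thesis unfolding x2e c\<alpha>e[symmetric] defs by (simp add: algebra_simps)
  qed
  have d: "d = \<delta> * d0"
  proof -
    have "d = \<delta> * ((x1 * \<gamma> * \<alpha>) ^ (Q + 1) + \<beta> * ((\<gamma> * x2) * (\<gamma> ^ Q * x2 ^ Q)))"
      unfolding abcd e1e e2e by (simp add: power_mult_distrib algebra_simps)
    thus ?thesis unfolding x2e c\<alpha>e[symmetric] defs by simp
  qed
  \<comment> \<open>The signs stay until this pencil has yielded \<open>p = 2\<close>; only then may
    they be dropped to reach the normal form.\<close>
  have G: "form a0 (- b0) (- c0) d0 = (\<lambda>x. (\<alpha> * x - cj \<alpha>) ^ (Q + 1) + \<beta> * (x - 1) ^ (Q + 1))"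
    unfolding defs by (rule ext) (simp add: form_def Q_diff power_mult_distrib algebra_simps)
  have "form a0 (- b0) (- c0) d0 x = inverse \<delta> * form a b c d (inverse \<gamma> * x)" for x
    unfolding a b c d form_scale using \<delta> \<gamma> by (simp flip: mult.assoc)
  hence "form a0 (- b0) (- c0) d0 = (\<lambda>x. inverse \<delta> * form a b c d (inverse \<gamma> * x))" ..
  moreover have "inverse \<gamma> \<in> mu" using x(2) by (simp add: \<gamma>_def)
  ultimately have "admissible (Q + 1) (form a0 (- b0) (- c0) d0)"
    using admissible_scale[OF adm] \<delta> by simp
  hence cond: "cj \<beta> \<noteq> \<beta>" "p = 2" "multiplicity 2 k \<le> multiplicity 2 l"
    unfolding G admissible_rational_pencil[OF c\<alpha>] by auto
  have "normal_form a0 b0 c0 d0"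
    unfolding normal_form_def power_q_Q cj_def[symmetric] defs using cond c\<alpha> by blast
  moreover have "b = \<delta> * (b0 * \<gamma> ^ Q)" "c = \<delta> * (c0 * \<gamma>)"
    using b c unfolding minus_eq_self[OF cond(2)] .
  ultimately show ?thesis
    unfolding equivalent_normal_form_def using cond(2) a d \<delta> \<gamma>(1) by blast
qed

text \<open>Dividing by e v1^(Q+1) makes the constant term of v equal to 1 and leaves \<alpha> = cj
  v0 / cj v1. Exchanging both v with v~ and e with f covers a vanishing e or v1; if that fails too,
  A is a multiple of x^(Q+1).\<close>

lemma normalize_Suc_Q:
  assumes m: "multiplicity 2 k \<noteq> multiplicity 2 l"
    and v: "v0 * cj v0 \<noteq> v1 * cj v1" and e: "e * cj e \<noteq> f * cj f"
    and abcd: "a = e * v0 ^ (Q + 1) + f * cj v1 ^ (Q + 1)"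
      "b = e * (v1 * v0 ^ Q) + f * (cj v0 * cj v1 ^ Q)"
      "c = e * (v0 * v1 ^ Q) + f * (cj v1 * cj v0 ^ Q)"
      "d = e * v1 ^ (Q + 1) + f * cj v0 ^ (Q + 1)"
  shows "equivalent_normal_form a b c d"
proof -
  have gen: "equivalent_normal_form a b c d"
    if "e \<noteq> 0" "v1 \<noteq> 0" and v: "v0 * cj v0 \<noteq> v1 * cj v1" and e: "e * cj e \<noteq> f * cj f"
      and abcd: "a = e * v0 ^ (Q + 1) + f * cj v1 ^ (Q + 1)"
        "b = e * (v1 * v0 ^ Q) + f * (cj v0 * cj v1 ^ Q)"
        "c = e * (v0 * v1 ^ Q) + f * (cj v1 * cj v0 ^ Q)"
        "d = e * v1 ^ (Q + 1) + f * cj v0 ^ (Q + 1)" for v0 v1 e f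
  proof -
    define \<alpha> \<delta> \<beta> where defs: "\<alpha> = cj v0 / cj v1" "\<delta> = e * v1 ^ (Q + 1)" "\<beta> = f / e * (cj v1 / v1) ^ (Q + 1)"
    have \<delta>: "\<delta> \<noteq> 0" using that by (simp add: defs)
    have "\<alpha> \<notin> mu" unfolding defs using v that by (intro ratio_notin_mu) (auto simp: mult.commute)
    moreover have "\<beta> \<notin> mu"
    proof
      assume "\<beta> \<in> mu"
      hence "\<beta> / (cj v1 / v1) ^ (Q + 1) \<in> mu" using that(2) by (intro mu_divide mu_power cj_div_self_mu)
      hence "f / e \<in> mu" using that(2) by (simp add: defs)
      thus False using ratio_notin_mu[OF e[symmetric] that(1)] by simp
    qed
    moreover have v0: "v0 = cj \<alpha> * v1" "cj v0 = \<alpha> * cj v1" using that(2) by (simp_all add: defs)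
    have f: "f * cj v1 ^ (Q + 1) = \<delta> * \<beta>"
      using that by (simp add: defs power_divide)
    have "a = \<delta> * (cj \<alpha> ^ (Q + 1) + \<beta>)"
      unfolding abcd f distrib_left unfolding v0 by (simp add: defs(2) power_mult_distrib)
    moreover have "b = \<delta> * (cj \<alpha> ^ Q + \<alpha> * \<beta>)"
    proof -
      have "b = e * (v1 * v0 ^ Q) + \<alpha> * (f * cj v1 ^ (Q + 1))" unfolding abcd v0(2) by simp
      thus ?thesis unfolding f unfolding v0 by (simp add: defs(2) power_mult_distrib algebra_simps)
    qed
    moreover have "c = \<delta> * (cj \<alpha> + \<alpha> ^ Q * \<beta>)"
    proof -
      have "c = e * (v0 * v1 ^ Q) + \<alpha> ^ Q * (f * cj v1 ^ (Q + 1))"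
        unfolding abcd v0(2) by (simp add: power_mult_distrib)
      thus ?thesis unfolding f unfolding v0 by (simp add: defs(2) power_mult_distrib algebra_simps)
    qed
    moreover have "d = \<delta> * (1 + \<alpha> ^ (Q + 1) * \<beta>)"
    proof -
      have "d = e * v1 ^ (Q + 1) + \<alpha> ^ (Q + 1) * (f * cj v1 ^ (Q + 1))"
        unfolding abcd v0(2) by (simp add: power_mult_distrib)
      thus ?thesis unfolding f by (simp add: defs(2) algebra_simps)
    qed
    ultimately show ?thesis
      using m by (intro equivalent_normal_formI[OF \<delta>, of "cj \<alpha> ^ (Q + 1) + \<beta>" "cj \<alpha> ^ Q + \<alpha> * \<beta>"
          "cj \<alpha> + \<alpha> ^ Q * \<beta>" "1 + \<alpha> ^ (Q + 1) * \<beta>"])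
        (unfold normal_form_def power_q_Q cj_def[symmetric], blast+)
  qed
  have mono: "equivalent_normal_form a b c d" if "a \<noteq> 0" "b = 0" "c = 0" "d = 0"
    using that m by (intro equivalent_normal_formI[of a 1 0 0 0]) (auto simp: normal_form_def)
  consider "e \<noteq> 0" "v1 \<noteq> 0" | "f \<noteq> 0" "v0 \<noteq> 0" | "e = 0" "v0 = 0" | "f = 0" "v1 = 0"
    using v e by auto
  thus ?thesis
  proof cases
    case 1
    thus ?thesis using gen v e abcd by blast
  next
    case 2
    show ?thesis
      \<comment> \<open>The exchange replaces (v0, v1) by (cj v1, cj v0), the coefficients of
        v~.\<close>
      by (rule gen[of f "cj v0" "cj v1" e]) (use 2 v e abcd in \<open>auto simp: mult.commute\<close>)
  next
    case 3
    have "a \<noteq> 0" "b = 0" "c = 0" "d = 0" using 3 v e Q_pos abcd by auto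
    thus ?thesis by (rule mono)
  next
    case 4
    have "a \<noteq> 0" "b = 0" "c = 0" "d = 0" using 4 v e Q_pos abcd by auto
    thus ?thesis by (rule mono)
  qed
qed

text \<open>The same normalization and exchange for v~ v^Q; the divisor is now e (cj v1) v1^Q, and
  the exceptional forms are multiples of x^Q.\<close>

lemma normalize_Q_minus:
  assumes m: "multiplicity 2 l \<le> multiplicity 2 k"
    and v: "v0 * cj v0 \<noteq> v1 * cj v1" and e: "e * cj e \<noteq> f * cj f"
    and abcd: "a = e * (cj v1 * v0 ^ Q) + f * (v0 * cj v1 ^ Q)"
      "b = e * (cj v0 * v0 ^ Q) + f * (v1 * cj v1 ^ Q)"
      "c = e * (cj v1 * v1 ^ Q) + f * (v0 * cj v0 ^ Q)"
      "d = e * (cj v0 * v1 ^ Q) + f * (v1 * cj v0 ^ Q)"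
  shows "equivalent_normal_form a b c d"
proof -
  have gen: "equivalent_normal_form a b c d"
    if "e \<noteq> 0" "v1 \<noteq> 0" and v: "v0 * cj v0 \<noteq> v1 * cj v1" and e: "e * cj e \<noteq> f * cj f"
      and abcd: "a = e * (cj v1 * v0 ^ Q) + f * (v0 * cj v1 ^ Q)"
        "b = e * (cj v0 * v0 ^ Q) + f * (v1 * cj v1 ^ Q)"
        "c = e * (cj v1 * v1 ^ Q) + f * (v0 * cj v0 ^ Q)"
        "d = e * (cj v0 * v1 ^ Q) + f * (v1 * cj v0 ^ Q)" for v0 v1 e f
  proof -
    define \<alpha> \<delta> \<beta> where defs: "\<alpha> = cj v0 / cj v1" "\<delta> = e * (cj v1 * v1 ^ Q)"
      "\<beta> = f / e * ((cj v1 / v1) ^ Q / (cj v1 / v1))"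
    have \<delta>: "\<delta> \<noteq> 0" using that by (simp add: defs)
    have "\<alpha> \<notin> mu" unfolding defs using v that by (intro ratio_notin_mu) (auto simp: mult.commute)
    moreover have "\<beta> \<notin> mu"
    proof
      assume "\<beta> \<in> mu"
      hence "\<beta> / ((cj v1 / v1) ^ Q / (cj v1 / v1)) \<in> mu"
        using that(2) by (intro mu_divide mu_power cj_div_self_mu)
      hence "f / e \<in> mu" using that(2) by (simp add: defs)
      thus False using ratio_notin_mu[OF e[symmetric] that(1)] by simp
    qed
    moreover have v0: "v0 = cj \<alpha> * v1" "cj v0 = \<alpha> * cj v1" using that(2) by (simp_all add: defs)
    have f: "f * (v1 * cj v1 ^ Q) = \<delta> * \<beta>"
      using that by (simp add: defs power_divide)
    have "a = \<delta> * (cj \<alpha> ^ Q + cj \<alpha> * \<beta>)"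
    proof -
      have "a = e * (cj v1 * v0 ^ Q) + cj \<alpha> * (f * (v1 * cj v1 ^ Q))"
        unfolding abcd by (simp add: v0(1))
      thus ?thesis unfolding f unfolding v0 by (simp add: defs(2) power_mult_distrib algebra_simps)
    qed
    moreover have "b = \<delta> * (cj \<alpha> ^ Q * \<alpha> + \<beta>)"
      unfolding abcd f distrib_left unfolding v0 by (simp add: defs(2) power_mult_distrib)
    moreover have "c = \<delta> * (1 + cj \<alpha> * \<alpha> ^ Q * \<beta>)"
    proof -
      have "c = e * (cj v1 * v1 ^ Q) + cj \<alpha> * \<alpha> ^ Q * (f * (v1 * cj v1 ^ Q))"
        unfolding abcd v0(2) unfolding v0(1) by (simp add: power_mult_distrib)
      thus ?thesis unfolding f by (simp add: defs(2) algebra_simps)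
    qed
    moreover have "d = \<delta> * (\<alpha> + \<alpha> ^ Q * \<beta>)"
    proof -
      have "d = e * (\<alpha> * cj v1 * v1 ^ Q) + \<alpha> ^ Q * (f * (v1 * cj v1 ^ Q))"
        unfolding abcd v0(2) by (simp add: power_mult_distrib)
      thus ?thesis unfolding f by (simp add: defs(2) algebra_simps)
    qed
    ultimately show ?thesis
      using m by (intro equivalent_normal_formI[OF \<delta>, of "cj \<alpha> ^ Q + cj \<alpha> * \<beta>" "cj \<alpha> ^ Q * \<alpha> + \<beta>"
          "1 + cj \<alpha> * \<alpha> ^ Q * \<beta>" "\<alpha> + \<alpha> ^ Q * \<beta>"])
        (unfold normal_form_def power_q_Q cj_def[symmetric], blast+)
  qed
  have mono: "equivalent_normal_form a b c d" if "b \<noteq> 0" "a = 0" "c = 0" "d = 0"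
    using that m by (intro equivalent_normal_formI[of b 0 1 0 0]) (auto simp: normal_form_def)
  consider "e \<noteq> 0" "v1 \<noteq> 0" | "f \<noteq> 0" "v0 \<noteq> 0" | "e = 0" "v0 = 0" | "f = 0" "v1 = 0"
    using v e by auto
  thus ?thesis
  proof cases
    case 1
    thus ?thesis using gen v e abcd by blast
  next
    case 2
    show ?thesis
      by (rule gen[of f "cj v0" "cj v1" e]) (use 2 v e abcd in \<open>auto simp: mult.commute\<close>)
  next
    case 3
    have "b \<noteq> 0" "a = 0" "c = 0" "d = 0" using 3 v e Q_pos abcd by auto
    thus ?thesis by (rule mono)
  next
    case 4
    have "b \<noteq> 0" "a = 0" "c = 0" "d = 0" using 4 v e Q_pos abcd by auto
    thus ?thesis by (rule mono)
  qed
qed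

lemma equivalent_normal_form_if_admissible:
  assumes adm: "admissible (Q + 1) (form a b c d)"
  shows "p = 2 \<and> equivalent_normal_form a b c d"
proof (cases "\<exists>y\<in>mu. (cj d - y * a) * (cj a - y * d) = (cj c - y * b) * (cj b - y * c)")
  case True
  then obtain y where y: "y \<in> mu"
    "(cj d - y * a) * (cj a - y * d) = (cj c - y * b) * (cj b - y * c)" by blast
  obtain e1 e2 x1 x2 where "x1 \<in> mu" "x2 \<in> mu" "x1 \<noteq> x2" "e1 \<noteq> 0" "a = e1 + e2"
    "b = - (e1 * x1 + e2 * x2)" "c = - (e1 * x1 ^ Q + e2 * x2 ^ Q)"
    "d = e1 * x1 ^ (Q + 1) + e2 * x2 ^ (Q + 1)"
    by (rule pencil_two_roots[OF adm y])
  thus ?thesis by (rule normalize_rational_pencil[OF adm])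
next
  case False
  hence noroot: "(cj d - y * a) * (cj a - y * d) \<noteq> (cj c - y * b) * (cj b - y * c)"
    if "y \<in> mu" for y using that by blast
  obtain e f u0 u1 v0 v1 where ef: "e * cj e \<noteq> f * cj f"
    and abcd: "a = e * (u0 * v0 ^ Q) + f * (cj u1 * cj v1 ^ Q)"
    "b = e * (u1 * v0 ^ Q) + f * (cj u0 * cj v1 ^ Q)"
    "c = e * (u0 * v1 ^ Q) + f * (cj u1 * cj v0 ^ Q)"
    "d = e * (u1 * v1 ^ Q) + f * (cj u0 * cj v0 ^ Q)"
    by (rule pencil_no_root_mu[OF noroot])
  define B where "B x = (u0 * x + u1) * (v0 * x + v1) ^ Q" for x
  have B: "B = form (u0 * v0 ^ Q) (u1 * v0 ^ Q) (u0 * v1 ^ Q) (u1 * v1 ^ Q)"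
    by (rule ext) (simp only: B_def form_rank_one)
  have "form a b c d x = e * B x + f * tw (Q + 1) B x" if "x \<in> mu" for x
    unfolding B tw_form[OF that] abcd by (simp add: form_def algebra_simps)
  hence "admissible (Q + 1) (form a b c d) \<longleftrightarrow> admissible (Q + 1) (\<lambda>x. e * B x + f * tw (Q + 1) B x)"
    by (rule admissible_cong)
  hence admB: "admissible (Q + 1) B" using admissible_combine[OF ef] adm by blast
  hence Bnz: "B x \<noteq> 0" if "x \<in> mu" for x using that by (simp add: admissible_def)
  \<comment> \<open>Equal norms would put a zero of this linear factor, hence of B, on
    \<open>mu\<close>.\<close>
  have u: "u0 * cj u0 \<noteq> u1 * cj u1"
  proof
    assume "u0 * cj u0 = u1 * cj u1"
    then obtain x where "x \<in> mu" "u0 * x + u1 = 0" using linear_root_mu by blast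
    thus False using Bnz[of x] by (simp add: B_def)
  qed
  have v: "v0 * cj v0 \<noteq> v1 * cj v1"
  proof
    assume "v0 * cj v0 = v1 * cj v1"
    then obtain x where "x \<in> mu" "v0 * x + v1 = 0" using linear_root_mu by blast
    thus False using Bnz[of x] Q_pos by (simp add: B_def)
  qed
  define M where "M = v0 * cj v0 - v1 * cj v1"
  have M: "M \<noteq> 0" using v by (simp add: M_def)
  \<comment> \<open>Cramer's rule for u = e1 v + e2 v~; \<open>M\<close> is the determinant of the
    pair v, v~.\<close>
  define e1 e2 where e12: "e1 = (u0 * cj v0 - u1 * cj v1) / M" "e2 = (u1 * v0 - u0 * v1) / M"
  have Me: "M * e1 = u0 * cj v0 - u1 * cj v1" "M * e2 = u1 * v0 - u0 * v1"
    using M by (simp_all add: e12)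
  have "M * u0 = (M * e1) * v0 + (M * e2) * cj v1" "M * u1 = (M * e1) * v1 + (M * e2) * cj v0"
    unfolding Me by (simp_all add: M_def algebra_simps)
  hence "M * u0 = M * (e1 * v0 + e2 * cj v1)" "M * u1 = M * (e1 * v1 + e2 * cj v0)"
    by (simp_all only: distrib_left mult.assoc)
  hence u01: "u0 = e1 * v0 + e2 * cj v1" "u1 = e1 * v1 + e2 * cj v0" using M by simp_all
  \<comment> \<open>Determinants multiply, so the norms of \<open>e1\<close> and \<open>e2\<close>
    inherit inequality from those of \<open>u0\<close> and \<open>u1\<close>.\<close>
  have "u0 * cj u0 - u1 * cj u1 = (e1 * cj e1 - e2 * cj e2) * (v0 * cj v0 - v1 * cj v1)"
    unfolding u01 by (simp add: algebra_simps)
  hence e: "e1 * cj e1 \<noteq> e2 * cj e2" using u by auto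
  have lin: "u0 * x + u1 = e1 * (v0 * x + v1) + e2 * (cj v1 * x + cj v0)" for x
    unfolding u01 by (simp add: algebra_simps)
  have "B = (\<lambda>x. (e1 * (v0 * x + v1) + e2 * (cj v1 * x + cj v0)) * (v0 * x + v1) ^ Q)"
    by (rule ext) (simp only: B_def lin)
  from this admB have "admissible (Q + 1)
      (\<lambda>x. (e1 * (v0 * x + v1) + e2 * (cj v1 * x + cj v0)) * (v0 * x + v1) ^ Q)" by (rule subst[where P = "admissible (Q + 1)"])
  hence "e2 = 0 \<and> p = 2 \<and> multiplicity 2 k \<noteq> multiplicity 2 l \<or>
         e1 = 0 \<and> p = 2 \<and> multiplicity 2 l \<le> multiplicity 2 k"
    by (rule pencil_cases[OF v e])
  thus ?thesis
  proof (elim disjE conjE)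
    assume *: "e2 = 0" "p = 2" "multiplicity 2 k \<noteq> multiplicity 2 l"
    \<comment> \<open>B = e1 v^(Q+1) gives B~ = (cj e1) v~^(Q+1), so the constants are absorbed into
      \<open>e * e1\<close> and \<open>f * cj e1\<close>.\<close>
    have "e1 * cj e1 * (e * cj e - f * cj f) \<noteq> 0" using e ef * by auto
    hence "(e * e1) * cj (e * e1) \<noteq> (f * cj e1) * cj (f * cj e1)" by (auto simp: algebra_simps)
    hence "equivalent_normal_form a b c d"
      by (rule normalize_Suc_Q[OF *(3) v]) (simp_all add: abcd u01 *(1) algebra_simps)
    thus ?thesis using * by simp
  next
    assume *: "e1 = 0" "p = 2" "multiplicity 2 l \<le> multiplicity 2 k"
    have "e2 * cj e2 * (e * cj e - f * cj f) \<noteq> 0" using e ef * by auto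
    hence "(e * e2) * cj (e * e2) \<noteq> (f * cj e2) * cj (f * cj e2)" by (auto simp: algebra_simps)
    hence "equivalent_normal_form a b c d"
      by (rule normalize_Q_minus[OF *(3) v]) (simp_all add: abcd u01 *(1) algebra_simps)
    thus ?thesis using * by simp
  qed
qed

end

section \<open>From coefficients back to polynomials\<close>

lemma poly_quadrinomial: "poly (quadrinomial Q a b c d) x = a * x ^ (Q + 1) + b * x ^ Q + c * x + d"
  by (simp add: quadrinomial_def poly_monom)

lemma smult_pcompose_quadrinomial:
  "smult \<delta> (pcompose (quadrinomial Q a b c d) [:0, \<gamma>:]) =
    quadrinomial Q (\<delta> * (a * \<gamma> ^ (Q + 1))) (\<delta> * (b * \<gamma> ^ Q)) (\<delta> * (c * \<gamma>)) (\<delta> * d)"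
proof -
  have "pcompose (monom u n) [:0, \<gamma>:] = monom (u * \<gamma> ^ n) n" for u n
    by (rule poly_eqI) (auto simp: coeff_pcompose_linear mult.commute)
  thus ?thesis
    by (simp only: quadrinomial_def pcompose_add smult_add_right smult_monom power_one_right
        power_0 mult_1_right)
qed

lemma monom_eq_quadrinomial:
  "monom 1 (Q + 1) = quadrinomial Q 1 0 0 0" "monom 1 Q = quadrinomial Q 0 1 0 0"
  by (simp_all add: quadrinomial_def)

text \<open>\<open>Q > 1\<close> keeps the exponents Q+1, Q, 1 and 0 distinct.\<close>

lemma quadrinomial_eq_iff:
  assumes "Q > 1"
  shows "quadrinomial Q a b c d = quadrinomial Q a' b' c' d' \<longleftrightarrow>
    a = a' \<and> b = b' \<and> c = c' \<and> d = d'"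
proof -
  have "coeff (quadrinomial Q a b c d) (Q + 1) = a" "coeff (quadrinomial Q a b c d) Q = b"
    "coeff (quadrinomial Q a b c d) 1 = c" "coeff (quadrinomial Q a b c d) 0 = d"
    for a b c d :: 'a
    using assms by (auto simp: quadrinomial_def)
  thus ?thesis by metis
qed

lemma (in quadratic_field_frobenius) equivalent_normal_form_iff:
  "equivalent_normal_form a b c d \<longleftrightarrow> (\<exists>\<gamma>\<in>mu. \<exists>\<delta>. \<delta> \<noteq> 0 \<and> (\<exists>a0 b0 c0 d0.
    quadrinomial Q a b c d = smult \<delta> (pcompose (quadrinomial Q a0 b0 c0 d0) [:0, \<gamma>:]) \<and>
    normal_form a0 b0 c0 d0))"
proof -
  have "Q > 1" unfolding Q_def by (rule one_less_power[OF prime_gt_1_nat[OF prime_p] l_pos])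
  thus ?thesis
    unfolding smult_pcompose_quadrinomial equivalent_normal_form_def
    by (simp only: quadrinomial_eq_iff conj_assoc)
qed

theorem theorem1p2:
  fixes p k l q Q r :: nat
    and a b c d :: "'a::finite_field"
    and A :: "'a poly"
  assumes "prime p" and "k > 0" and "l > 0"
    and "q = p ^ k" and "Q = p ^ l"
    and "CARD('a) = q\<^sup>2"
    and "r > 0" and "[r = Q + 1] (mod (q + 1))"
    and "A = quadrinomial Q a b c d"
  shows "permutation_poly (monom 1 r * pcompose A (monom 1 (q - 1))) \<longleftrightarrow>
    p = 2 \<and> gcd r (q - 1) = 1 \<and>
    (\<exists>\<gamma> \<in> roots_of_unity (q + 1). \<exists>\<delta>. \<delta> \<noteq> 0 \<and>
      (\<exists>A\<^sub>0 :: 'a poly. A = smult \<delta> (pcompose A\<^sub>0 [:0, \<gamma>:]) \<and>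
        ((multiplicity 2 k \<le> multiplicity 2 l \<and>
          (\<exists>\<alpha> \<in> - subfield_of_order q. \<exists>\<beta> \<in> - subfield_of_order q.
            A\<^sub>0 = quadrinomial Q
              (\<alpha> ^ (Q + 1) + \<beta>)
              (\<alpha> ^ (q + Q) + \<beta>)
              (\<alpha> ^ (q * Q + 1) + \<beta>)
              (\<alpha> ^ (q * Q + q) + \<beta>))) \<or>
         (multiplicity 2 k \<noteq> multiplicity 2 l \<and>
          (A\<^sub>0 = monom 1 (Q + 1) \<or>
           (\<exists>\<alpha> \<in> - roots_of_unity (q + 1). \<exists>\<beta> \<in> - roots_of_unity (q + 1).
            A\<^sub>0 = quadrinomial Q
              (\<alpha> ^ (q * Q + q) + \<beta>)
              (\<alpha> ^ (q * Q) + \<alpha> * \<beta>)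
              (\<alpha> ^ q + \<alpha> ^ Q * \<beta>)
              (1 + \<alpha> ^ (Q + 1) * \<beta>)))) \<or>
         (multiplicity 2 k \<ge> multiplicity 2 l \<and>
          (A\<^sub>0 = monom 1 Q \<or>
           (\<exists>\<alpha> \<in> - roots_of_unity (q + 1). \<exists>\<beta> \<in> - roots_of_unity (q + 1).
            A\<^sub>0 = quadrinomial Q
              (\<alpha> ^ (q * Q) + \<alpha> ^ q * \<beta>)
              (\<alpha> ^ (q * Q + 1) + \<beta>)
              (1 + \<alpha> ^ (q + Q) * \<beta>)
              (\<alpha> + \<alpha> ^ Q * \<beta>)))))))"
proof -
  interpret quadratic_field_frobenius "TYPE('a)" p k q l Q
    by unfold_locales (use assms in auto)
  have A: "poly A = form a b c d"
    by (rule ext) (simp only: assms(9) poly_quadrinomial form_def)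
  have f: "poly (monom 1 r * pcompose A (monom 1 (q - 1))) = (\<lambda>x. x ^ r * poly A (x ^ (q - 1)))"
    by (rule ext) (simp only: poly_mult poly_monom poly_pcompose mult_1_left)
  have "subfield_of_order q = {x :: 'a. x ^ q = x}"
    unfolding assms(4) by (rule subfield_of_order_eq[OF assms(1,2) assms(6)[unfolded assms(4)]])
  hence sub: "- subfield_of_order q = {x. cj x \<noteq> x}" unfolding cj_def by blast
  have rou: "roots_of_unity (q + 1) = mu"
    unfolding roots_of_unity_def using mu_iff_power by blast
  \<comment> \<open>The theorem describes a polynomial, \<open>normal_form\<close> its coefficients;
    both monomials are read as quadrinomials with three zero coefficients.\<close>
  have nf: "(\<exists>a0 b0 c0 d0. normal_form a0 b0 c0 d0 \<and> A\<^sub>0 = quadrinomial Q a0 b0 c0 d0) \<longleftrightarrow>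
      ((multiplicity 2 k \<le> multiplicity 2 l \<and>
          (\<exists>\<alpha> \<in> - subfield_of_order q. \<exists>\<beta> \<in> - subfield_of_order q.
            A\<^sub>0 = quadrinomial Q
              (\<alpha> ^ (Q + 1) + \<beta>)
              (\<alpha> ^ (q + Q) + \<beta>)
              (\<alpha> ^ (q * Q + 1) + \<beta>)
              (\<alpha> ^ (q * Q + q) + \<beta>))) \<or>
         (multiplicity 2 k \<noteq> multiplicity 2 l \<and>
          (A\<^sub>0 = monom 1 (Q + 1) \<or>
           (\<exists>\<alpha> \<in> - roots_of_unity (q + 1). \<exists>\<beta> \<in> - roots_of_unity (q + 1).
            A\<^sub>0 = quadrinomial Q
              (\<alpha> ^ (q * Q + q) + \<beta>)
              (\<alpha> ^ (q * Q) + \<alpha> * \<beta>)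
              (\<alpha> ^ q + \<alpha> ^ Q * \<beta>)
              (1 + \<alpha> ^ (Q + 1) * \<beta>)))) \<or>
         (multiplicity 2 k \<ge> multiplicity 2 l \<and>
          (A\<^sub>0 = monom 1 Q \<or>
           (\<exists>\<alpha> \<in> - roots_of_unity (q + 1). \<exists>\<beta> \<in> - roots_of_unity (q + 1).
            A\<^sub>0 = quadrinomial Q
              (\<alpha> ^ (q * Q) + \<alpha> ^ q * \<beta>)
              (\<alpha> ^ (q * Q + 1) + \<beta>)
              (1 + \<alpha> ^ (q + Q) * \<beta>)
              (\<alpha> + \<alpha> ^ Q * \<beta>)))))" (is "_ \<longleftrightarrow> ?normal A\<^sub>0") for A\<^sub>0 :: "'a poly"
  proof
    assume "\<exists>a0 b0 c0 d0. normal_form a0 b0 c0 d0 \<and> A\<^sub>0 = quadrinomial Q a0 b0 c0 d0"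
    then obtain a0 b0 c0 d0 where nf: "normal_form a0 b0 c0 d0"
      and A0: "A\<^sub>0 = quadrinomial Q a0 b0 c0 d0" by blast
    from nf[unfolded normal_form_def] show "?normal A\<^sub>0"
      unfolding A0 sub rou monom_eq_quadrinomial[of Q]
    proof (elim disjE conjE exE, goal_cases)
      case (1 \<alpha> \<beta>)
      show ?case
        by (intro disjI1 conjI bexI[of _ \<alpha>] bexI[of _ \<beta>]) (simp_all only: 1 mem_Collect_eq simp_thms)
    next
      case 2
      show ?case by (rule disjI2, rule disjI1, intro conjI disjI1) (simp_all only: 2 simp_thms)
    next
      case (3 \<alpha> \<beta>)
      show ?case
        by (rule disjI2, rule disjI1, intro conjI disjI2 bexI[of _ \<alpha>] bexI[of _ \<beta>])
          (simp_all only: 3 Compl_iff simp_thms)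
    next
      case 4
      show ?case by (rule disjI2, rule disjI2, intro conjI disjI1) (simp_all only: 4 simp_thms)
    next
      case (5 \<alpha> \<beta>)
      show ?case
        by (rule disjI2, rule disjI2, intro conjI disjI2 bexI[of _ \<alpha>] bexI[of _ \<beta>])
          (simp_all only: 5 Compl_iff simp_thms)
    qed
  next
    have ex: "\<exists>a0 b0 c0 d0. normal_form a0 b0 c0 d0 \<and> quadrinomial Q a b c d = quadrinomial Q a0 b0 c0 d0"
      if "normal_form a b c d" for a b c d using that by blast
    assume "?normal A\<^sub>0"
    thus "\<exists>a0 b0 c0 d0. normal_form a0 b0 c0 d0 \<and> A\<^sub>0 = quadrinomial Q a0 b0 c0 d0"
      unfolding sub rou monom_eq_quadrinomial[of Q]
    proof (elim disjE conjE bexE, goal_cases)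
      case (1 \<alpha> \<beta>)
      note hyps = 1(1-3)[unfolded mem_Collect_eq]
      show ?case unfolding 1(4)
        by (rule ex, unfold normal_form_def, rule disjI1, rule conjI[OF hyps(1)], rule exI[of _ \<alpha>], rule exI[of _ \<beta>])
          (simp_all only: hyps simp_thms)
    next
      case 2
      note hyps = 2(1)[unfolded mem_Collect_eq]
      show ?case unfolding 2(2)
        by (rule ex, unfold normal_form_def, rule disjI2, rule disjI1, rule conjI[OF hyps], rule disjI1)
          (simp_all only: hyps simp_thms)
    next
      case (3 \<alpha> \<beta>)
      note hyps = 3(1-3)[unfolded Compl_iff]
      show ?case unfolding 3(4)
        by (rule ex, unfold normal_form_def, rule disjI2, rule disjI1, rule conjI[OF hyps(1)], rule disjI2, rule exI[of _ \<alpha>], rule exI[of _ \<beta>])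
          (simp_all only: hyps simp_thms)
    next
      case 4
      note hyps = 4(1)[unfolded mem_Collect_eq]
      show ?case unfolding 4(2)
        by (rule ex, unfold normal_form_def, rule disjI2, rule disjI2, rule conjI[OF hyps], rule disjI1)
          (simp_all only: hyps simp_thms)
    next
      case (5 \<alpha> \<beta>)
      note hyps = 5(1-3)[unfolded Compl_iff]
      show ?case unfolding 5(4)
        by (rule ex, unfold normal_form_def, rule disjI2, rule disjI2, rule conjI[OF hyps(1)], rule disjI2, rule exI[of _ \<alpha>], rule exI[of _ \<beta>])
          (simp_all only: hyps simp_thms)
    qed
  qed
  have "permutation_poly (monom 1 r * pcompose A (monom 1 (q - 1))) \<longleftrightarrow>
      coprime r (q - 1) \<and> admissible (Q + 1) (form a b c d)"
    unfolding permutation_poly_def f A by (rule bij_iff_admissible[OF assms(7,8)])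
  also have "\<dots> \<longleftrightarrow> p = 2 \<and> gcd r (q - 1) = 1 \<and> equivalent_normal_form a b c d"
    unfolding coprime_iff_gcd_eq_1[symmetric]
    using equivalent_normal_form_if_admissible[of a b c d] admissible_equivalent_normal_form[of a b c d]
    by blast
  also have "equivalent_normal_form a b c d \<longleftrightarrow>
      (\<exists>\<gamma> \<in> roots_of_unity (q + 1). \<exists>\<delta>. \<delta> \<noteq> 0 \<and>
        (\<exists>A\<^sub>0 :: 'a poly. A = smult \<delta> (pcompose A\<^sub>0 [:0, \<gamma>:]) \<and> ?normal A\<^sub>0))"
    unfolding nf[symmetric] unfolding equivalent_normal_form_iff rou assms(9)
    by (intro bex_cong ex_cong1 conj_cong refl) metis
  finally show ?thesis .
qed

end
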